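(* Let $\Omega\subset\mathbb{R}^N$ be a bounded open set and let $a:\Omega\times\mathbb{R}\times\mathbb{R}^N\to\mathbb{R}^N$ be a Carathéodory function satisfying $|a(x,s,\xi)|\leq\beta(1+|\xi|)$ for some $\beta>0$, for all $(s,\xi)\in\mathbb{R}\times\mathbb{R}^N$ and a.e. $x\in\Omega$. Let $2<p<N$, $\lambda\in\mathbb{R}$, and let $f\in L^q(\Omega)$ for some $q$ such that $1\leq q<\frac Np$. Let $u\in W^{1,p}_0(\Omega)$ be a subsolution, in the sense of distributions, of $$-\operatorname{div}(a(x,u,\nabla u))+\lambda u+|\nabla u|^p\leq f(x)\qquad\text{in }\Omega.$$ Then $$u\in L^s(\Omega)\quad\text{with } s=\frac{Npq}{N-pq},\qquad\text{and}\qquad \|u\|_{L^s(\Omega)}\leq C,$$ where the bound $C$ depends on $\beta,p,N,q,\lambda,|\Omega|,\|f\|_{L^q(\Omega)}$ in the case where $\frac{N(p-1)}{N(p-2)+p}\leq q<\frac Np$, while it also depends on the $L^p$ norm of $|\nabla u|$ in the case where $1\leq q<\frac{N(p-1)}{N(p-2)+p}$.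
   Context: Carathéodory function: measurable in $x$ for every fixed $(s,\xi)$ and continuous in $(s,\xi)$ for a.e. $x$. $|\Omega|$ is the Lebesgue measure of $\Omega$. Subsolution in the sense of distributions means that for every $\varphi\in C^\infty_0(\Omega)$ (smooth, compactly supported) with $\varphi\ge0$, $$\int_\Omega a(x,u,\nabla u)\cdot\nabla\varphi\,dx+\lambda\int_\Omega u\,\varphi\,dx+\int_\Omega|\nabla u|^p\varphi\,dx\leq\int_\Omega f\varphi\,dx.$$ *)

theory Defs
  imports "HOL-Analysis.Analysis"
begin

section \<open>Lebesgue spaces\<close>

definition Lp :: "real \<Rightarrow> 'a::euclidean_space set \<Rightarrow> ('a \<Rightarrow> 'b::real_normed_vector) set" where
  "Lp p \<Omega> = {f \<in> borel_measurable (lebesgue_on \<Omega>).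
               integrable (lebesgue_on \<Omega>) (\<lambda>x. norm (f x) powr p)}"

text \<open>Meaningful only on \<open>Lp p \<Omega>\<close>: the Bochner integral of a non-integrable function is 0.\<close>

definition Lp_norm :: "real \<Rightarrow> 'a::euclidean_space set \<Rightarrow> ('a \<Rightarrow> 'b::real_normed_vector) \<Rightarrow> real" where
  "Lp_norm p \<Omega> f = (\<integral>x. norm (f x) powr p \<partial>(lebesgue_on \<Omega>)) powr (1 / p)"

definition locally_integrable :: "'a::euclidean_space set \<Rightarrow> ('a \<Rightarrow> 'b::euclidean_space) \<Rightarrow> bool" where
  "locally_integrable \<Omega> f \<longleftrightarrow>
     (\<forall>K. compact K \<and> K \<subseteq> \<Omega> \<longrightarrow> integrable (lebesgue_on K) f)"

section \<open>Test functions\<close>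

primrec C_k :: "nat \<Rightarrow> ('a::euclidean_space \<Rightarrow> real) \<Rightarrow> bool" where
  "C_k 0 f \<longleftrightarrow> continuous_on UNIV f"
| "C_k (Suc k) f \<longleftrightarrow>
     f differentiable_on UNIV \<and> (\<forall>b\<in>Basis. C_k k (\<lambda>x. frechet_derivative f (at x) b))"

text \<open>Elements of \<open>C\<^sub>0\<^sup>\<infinity>(\<Omega>)\<close> are represented by their extension by zero to the whole space.\<close>

definition test_functions :: "'a::euclidean_space set \<Rightarrow> ('a \<Rightarrow> real) set" where
  "test_functions \<Omega> = {\<phi>. (\<forall>k. C_k k \<phi>) \<and>
     compact (closure {x. \<phi> x \<noteq> 0}) \<and> closure {x. \<phi> x \<noteq> 0} \<subseteq> \<Omega>}"

definition grad :: "('a::euclidean_space \<Rightarrow> real) \<Rightarrow> 'a \<Rightarrow> 'a" where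
  "grad \<phi> x = (\<Sum>b\<in>Basis. frechet_derivative \<phi> (at x) b *\<^sub>R b)"

section \<open>Sobolev spaces\<close>

definition has_weak_gradient ::
    "'a::euclidean_space set \<Rightarrow> ('a \<Rightarrow> real) \<Rightarrow> ('a \<Rightarrow> 'a) \<Rightarrow> bool" where
  "has_weak_gradient \<Omega> u g \<longleftrightarrow>
     locally_integrable \<Omega> u \<and> locally_integrable \<Omega> g \<and>
     (\<forall>\<phi>\<in>test_functions \<Omega>. \<forall>b\<in>Basis.
        (\<integral>x. u x * (grad \<phi> x \<bullet> b) \<partial>(lebesgue_on \<Omega>)) =
        - (\<integral>x. (g x \<bullet> b) * \<phi> x \<partial>(lebesgue_on \<Omega>)))"

text \<open>The weak gradient is determined only up to a null set; one representative is chosen.\<close>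

definition weak_grad :: "'a::euclidean_space set \<Rightarrow> ('a \<Rightarrow> real) \<Rightarrow> 'a \<Rightarrow> 'a" where
  "weak_grad \<Omega> u = (SOME g. has_weak_gradient \<Omega> u g)"

definition W1p :: "real \<Rightarrow> 'a::euclidean_space set \<Rightarrow> ('a \<Rightarrow> real) set" where
  "W1p p \<Omega> = {u \<in> Lp p \<Omega>. (\<exists>g. has_weak_gradient \<Omega> u g) \<and> weak_grad \<Omega> u \<in> Lp p \<Omega>}"

text \<open>The closure of the test functions in \<open>W1p p \<Omega>\<close>. The classical gradient of a test
  function is a representative of its weak gradient.\<close>

definition W1p0 :: "real \<Rightarrow> 'a::euclidean_space set \<Rightarrow> ('a \<Rightarrow> real) set" where
  "W1p0 p \<Omega> = {u \<in> W1p p \<Omega>. \<exists>\<phi>. (\<forall>n::nat. \<phi> n \<in> test_functions \<Omega>) \<and>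
     (\<lambda>n. Lp_norm p \<Omega> (\<lambda>x. u x - \<phi> n x)) \<longlonglongrightarrow> 0 \<and>
     (\<lambda>n. Lp_norm p \<Omega> (\<lambda>x. weak_grad \<Omega> u x - grad (\<phi> n) x)) \<longlonglongrightarrow> 0}"

section \<open>The equation\<close>

definition caratheodory ::
    "'a::euclidean_space set \<Rightarrow> ('a \<Rightarrow> real \<Rightarrow> 'a \<Rightarrow> 'a) \<Rightarrow> bool" where
  "caratheodory \<Omega> a \<longleftrightarrow>
     (\<forall>s \<xi>. (\<lambda>x. a x s \<xi>) \<in> borel_measurable (lebesgue_on \<Omega>)) \<and>
     (AE x in lebesgue_on \<Omega>. continuous_on UNIV (\<lambda>(s, \<xi>). a x s \<xi>))"

definition distributional_subsolution ::
    "'a::euclidean_space set \<Rightarrow> ('a \<Rightarrow> real \<Rightarrow> 'a \<Rightarrow> 'a) \<Rightarrow> real \<Rightarrow> real \<Rightarrow> ('a \<Rightarrow> real)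
      \<Rightarrow> ('a \<Rightarrow> real) \<Rightarrow> bool" where
  "distributional_subsolution \<Omega> a lam p f u \<longleftrightarrow>
     (\<forall>\<phi>\<in>test_functions \<Omega>. (\<forall>x\<in>\<Omega>. \<phi> x \<ge> 0) \<longrightarrow>
        (\<integral>x. a x (u x) (weak_grad \<Omega> u x) \<bullet> grad \<phi> x \<partial>(lebesgue_on \<Omega>))
        + lam * (\<integral>x. u x * \<phi> x \<partial>(lebesgue_on \<Omega>))
        + (\<integral>x. norm (weak_grad \<Omega> u x) powr p * \<phi> x \<partial>(lebesgue_on \<Omega>))
        \<le> (\<integral>x. f x * \<phi> x \<partial>(lebesgue_on \<Omega>)))"

end

theory Submission
  imports Defs
begin

text \<open>No ellipticity is needed: the absorbing term \<open>|\<nabla>u|\<^sup>p\<close> does all the work. Test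
  with \<open>\<psi>(u)\<close>, where \<open>\<psi> \<ge> 0\<close> is smooth, bounded, of order \<open>|t|\<^bsup>2m\<^esup>\<close> at \<open>0\<close> and of order \<open>|t|\<^sup>\<gamma>\<close>
  on a large range, and satisfies \<open>|t \<psi>'(t)| \<le> 4 m \<psi>(t)\<close>. The flux term is then of order
  \<open>|\<nabla>u|\<^sup>2 |\<psi>'(u)|\<close> and, as \<open>p > 2\<close>, Young's inequality absorbs it into \<open>|\<nabla>u|\<^sup>p \<psi>(u)\<close> up to a
  constant times \<open>1 + \<psi>(u)\<close>. Sobolev's inequality for \<open>|u| \<psi>(u)\<^bsup>1/p\<^esup>\<close> controls
  \<open>|u|\<^sup>p \<psi>(u)\<close> in \<open>L\<^sup>\<kappa>\<close>, \<open>\<kappa> = N/(N-p)\<close>, by the energy \<open>\<integral>|\<nabla>u|\<^sup>p \<psi>(u)\<close>, while Hoelder's inequality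
  bounds \<open>\<integral>|f| \<psi>(u)\<close> by a sublinear power of the same energy when \<open>\<gamma> = Np(q-1)/(N-pq)\<close>. The high
  order of vanishing of \<open>\<psi>\<close> at \<open>0\<close> makes the bound independent of the norm of \<open>\<nabla>u\<close> for all
  \<open>q\<close>. If the test functions \<open>\<phi>\<^sub>k\<close> tend to \<open>u\<close>, then the \<open>\<psi>(\<phi>\<^sub>k)\<close> are nonnegative test functions,
  so no chain rule for weak gradients is needed.\<close>

section \<open>Integrals along grid lines\<close>

text \<open>The weight \<psi> has to meet two demands. Near 0,
  \<open>|t \<psi>'(t)| \<le> 4 m \<psi>(t)\<close> leaves a factor 1/|t| in the flux, which Young's
  inequality raises to the power p/(p-2); this singularity is swallowed only if \<psi> vanishes to
  at least that order, which forces m to be large. The exponent 2m is an even integer so that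
  \<psi>(\<phi>) stays smooth where \<phi> vanishes. At infinity \<psi> is kept bounded: the energy
  is then finite before it is absorbed, and dominated convergence passes from \<phi>_k to u. All
  constants that survive are independent of the truncation, so Fatou's lemma removes it.

  With q' = q/(q-1), the exponent \<gamma> solves \<gamma> q' = (\<gamma> + p) \<kappa>, and the
  common value is s. Thus \<psi>(u)^q' is at most of the order of 1 + (|u|^p \<psi>(u))^\<kappa>,
  the term with f contributes the energy to the power \<kappa>/q', and \<kappa>/q' < 1 says exactly
  q < N/p. The term \<lambda> u, whatever its sign, is of lower order than |u|^p \<psi>(u) and is
  paid for by a small multiple of the energy and a constant depending on |\<Omega>|.\<close>

text \<open>Unlike \<open>powr\<close>, \<open>epow\<close> has \<open>epow 0 0 = 1\<close>: for an exponent \<open>0\<close> the first factor in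
  \<open>nn_integral_gridlines\<close> has to disappear.\<close>

definition epow :: "ennreal \<Rightarrow> real \<Rightarrow> ennreal" where
  "epow x a = (if a = 0 then 1 else if x = top then top else ennreal (enn2real x powr a))"

lemma epow_0_right [simp]: "epow x 0 = 1"
  by (simp add: epow_def)

lemma epow_ennreal: "a \<noteq> 0 \<Longrightarrow> 0 \<le> x \<Longrightarrow> epow (ennreal x) a = ennreal (x powr a)"
  by (simp add: epow_def)

lemma epow_mono: "0 \<le> a \<Longrightarrow> x \<le> y \<Longrightarrow> epow x a \<le> epow y a"
  by (auto simp: epow_def top_unique intro!: ennreal_leI powr_mono2 enn2real_mono)
     (simp add: less_top)

lemma epow_eq_0_iff: "epow x a = 0 \<longleftrightarrow> a \<noteq> 0 \<and> x = 0"
  by (cases x) (auto simp: epow_def)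

lemma epow_eq_top_iff: "epow x a = top \<longleftrightarrow> a \<noteq> 0 \<and> x = top"
  by (auto simp: epow_def)

lemma epow_add: "0 \<le> a \<Longrightarrow> 0 \<le> b \<Longrightarrow> epow x (a + b) = epow x a * epow x b"
  by (auto simp: epow_def ennreal_mult_top ennreal_top_mult powr_add ennreal_mult)

lemma measurable_epow [measurable]:
  assumes [measurable]: "f \<in> borel_measurable M"
  shows "(\<lambda>x. epow (f x) a) \<in> borel_measurable M"
  unfolding epow_def by measurable

text \<open>Jensen's inequality for \<open>exp\<close> at the points \<open>ln (x i)\<close>. If
  some \<open>x i\<close> is 0, the product vanishes whatever the weight is, because
  \<open>0 powr 0 = 0\<close>.\<close>

lemma weighted_arith_geom_mean:
  fixes x w :: "'i \<Rightarrow> real"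
  assumes "finite S" "\<And>i. i \<in> S \<Longrightarrow> 0 \<le> w i" "sum w S = 1" "\<And>i. i \<in> S \<Longrightarrow> 0 \<le> x i"
  shows "(\<Prod>i\<in>S. x i powr w i) \<le> (\<Sum>i\<in>S. w i * x i)"
proof (cases "\<exists>i\<in>S. x i = 0")
  case True
  then have "(\<Prod>i\<in>S. x i powr w i) = 0"
    using assms(1) by (intro prod_zero) auto
  moreover have "0 \<le> (\<Sum>i\<in>S. w i * x i)"
    using assms by (intro sum_nonneg mult_nonneg_nonneg) auto
  ultimately show ?thesis
    by linarith
next
  case False
  then have pos: "\<And>i. i \<in> S \<Longrightarrow> 0 < x i"
    using assms(4) by (metis less_eq_real_def)
  have ne: "S \<noteq> {}" using assms(3) by auto
  have "(\<Prod>i\<in>S. x i powr w i) = exp (\<Sum>i\<in>S. w i *\<^sub>R ln (x i))"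
    using pos assms(1) by (simp add: exp_sum powr_def less_imp_neq[THEN not_sym])
  also have "\<dots> \<le> (\<Sum>i\<in>S. w i * exp (ln (x i)))"
    by (rule convex_on_sum[OF assms(1) ne exp_convex assms(3)]) (use assms in auto)
  also have "\<dots> = (\<Sum>i\<in>S. w i * x i)"
    using pos by (intro sum.cong) auto
  finally show ?thesis .
qed

text \<open>Divide each factor by its integral and integrate the weighted arithmetic-geometric mean
  inequality; the weights sum to 1. This needs integrals that are neither 0 nor infinite. A zero
  integral makes the left side vanish and is treated first, because on the right it may meet an
  infinite factor and \<open>0 * top = 0\<close>.\<close>

lemma nn_integral_Holder_pos:
  fixes f :: "'i \<Rightarrow> 'a \<Rightarrow> ennreal"
  assumes S: "finite S" and w: "\<And>i. i \<in> S \<Longrightarrow> 0 < w i" "sum w S = 1"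
    and [measurable]: "\<And>i. i \<in> S \<Longrightarrow> f i \<in> borel_measurable M"
  shows "(\<integral>\<^sup>+x. (\<Prod>i\<in>S. epow (f i x) (w i)) \<partial>M) \<le> (\<Prod>i\<in>S. epow (\<integral>\<^sup>+x. f i x \<partial>M) (w i))"
proof -
  define c where "c i = (\<integral>\<^sup>+x. f i x \<partial>M)" for i
  consider (zero) i where "i \<in> S" "c i = 0" | (infty) i where "i \<in> S" "c i = top" "\<forall>j\<in>S. c j \<noteq> 0"
    | (fin) "\<forall>i\<in>S. c i \<noteq> 0 \<and> c i \<noteq> top"
    by blast
  then show ?thesis
  proof cases
    case zero
    then have "AE x in M. f i x = 0"
      by (subst nn_integral_0_iff_AE[symmetric]) (auto simp: c_def)
    then have "AE x in M. (\<Prod>i\<in>S. epow (f i x) (w i)) = 0"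
    proof eventually_elim
      case (elim x)
      then show ?case
        using zero S w(1)[of i] by (intro prod_zero bexI[of _ i]) (auto simp: epow_eq_0_iff)
    qed
    then have "(\<integral>\<^sup>+x. (\<Prod>i\<in>S. epow (f i x) (w i)) \<partial>M) = (\<integral>\<^sup>+x. 0 \<partial>M)"
      by (rule nn_integral_cong_AE)
    then show ?thesis by simp
  next
    case infty
    have "(\<Prod>i\<in>S. epow (c i) (w i)) = top"
      unfolding ennreal_prod_eq_top epow_eq_0_iff epow_eq_top_iff
      using infty S w(1) by (auto intro!: bexI[of _ i]) (use less_irrefl in fastforce)
    then show ?thesis
      by (simp add: c_def)
  next
    case fin
    define C where "C i = enn2real (c i)" for i
    have C: "c i = ennreal (C i)" "0 < C i" if "i \<in> S" for i
      using fin that by (auto simp: C_def less_top enn2real_positive_iff zero_less_iff_neq_zero)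
    have nt: "AE x in M. \<forall>i\<in>S. f i x \<noteq> top"
      using S
    proof (rule AE_finite_allI)
      fix i assume i: "i \<in> S"
      show "AE x in M. f i x \<noteq> top"
        using nn_integral_PInf_AE[of "f i" M] i fin by (auto simp: c_def)
    qed
    have "AE x in M. (\<Prod>i\<in>S. epow (f i x) (w i)) \<le>
        (\<Prod>i\<in>S. epow (c i) (w i)) * (\<Sum>i\<in>S. ennreal (w i / C i) * f i x)"
      using nt
    proof eventually_elim
      case (elim x)
      define y where "y i = enn2real (f i x)" for i
      have y: "f i x = ennreal (y i)" "0 \<le> y i" if "i \<in> S" for i
        using elim that by (auto simp: y_def less_top)
      have "(\<Prod>i\<in>S. y i powr w i) = (\<Prod>i\<in>S. C i powr w i) * (\<Prod>i\<in>S. (y i / C i) powr w i)"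
        unfolding prod.distrib[symmetric] using C(2)
        by (intro prod.cong) (auto simp: powr_divide dest!: less_imp_neq[THEN not_sym])
      also have "\<dots> \<le> (\<Prod>i\<in>S. C i powr w i) * (\<Sum>i\<in>S. w i * (y i / C i))"
        using S w y C(2) by (intro mult_left_mono weighted_arith_geom_mean prod_nonneg)
          (auto simp: less_imp_le)
      finally have "ennreal (\<Prod>i\<in>S. y i powr w i) \<le>
          ennreal ((\<Prod>i\<in>S. C i powr w i) * (\<Sum>i\<in>S. w i * (y i / C i)))"
        by (rule ennreal_leI)
      also have "\<dots> = (\<Prod>i\<in>S. ennreal (C i powr w i)) * (\<Sum>i\<in>S. ennreal (w i / C i * y i))"
        using y C(2) w(1)
        by (simp add: ennreal_mult prod_ennreal sum_ennreal prod_nonneg sum_nonneg less_imp_le)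
      also have "(\<Sum>i\<in>S. ennreal (w i / C i * y i)) = (\<Sum>i\<in>S. ennreal (w i / C i) * f i x)"
        using y C(2) w(1) by (intro sum.cong) (auto simp: ennreal_mult less_imp_le simp del: times_divide_eq_left)
      also have "(\<Prod>i\<in>S. ennreal (C i powr w i)) = (\<Prod>i\<in>S. epow (c i) (w i))"
      proof (intro prod.cong refl)
        fix i assume i: "i \<in> S"
        then show "ennreal (C i powr w i) = epow (c i) (w i)"
          using C[OF i] w(1)[OF i] by (simp add: epow_ennreal)
      qed
      also have "ennreal (\<Prod>i\<in>S. y i powr w i) = (\<Prod>i\<in>S. epow (f i x) (w i))"
        unfolding prod_ennreal[symmetric, OF powr_ge_zero]
      proof (intro prod.cong refl)
        fix i assume i: "i \<in> S"
        then show "ennreal (y i powr w i) = epow (f i x) (w i)"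
          using y[OF i] w(1)[OF i] by (simp add: epow_ennreal)
      qed
      finally show ?case .
    qed
    then have "(\<integral>\<^sup>+x. (\<Prod>i\<in>S. epow (f i x) (w i)) \<partial>M) \<le>
        (\<integral>\<^sup>+x. (\<Prod>i\<in>S. epow (c i) (w i)) * (\<Sum>i\<in>S. ennreal (w i / C i) * f i x) \<partial>M)"
      by (rule nn_integral_mono_AE)
    also have "\<dots> = (\<Prod>i\<in>S. epow (c i) (w i)) * (\<Sum>i\<in>S. ennreal (w i / C i) * c i)"
      by (simp add: nn_integral_cmult nn_integral_sum c_def)
    also have "(\<Sum>i\<in>S. ennreal (w i / C i) * c i) = (\<Sum>i\<in>S. ennreal (w i))"
      using C w(1) by (intro sum.cong refl)
       (simp add: less_imp_le ennreal_mult[symmetric] less_imp_neq[THEN not_sym])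
    also have "\<dots> = 1"
      using w by (simp add: sum_ennreal less_imp_le)
    finally show ?thesis by (simp add: c_def)
  qed
qed

lemma nn_integral_Holder:
  fixes f :: "'i \<Rightarrow> 'a \<Rightarrow> ennreal"
  assumes S: "finite S" and w: "\<And>i. i \<in> S \<Longrightarrow> 0 \<le> w i" "sum w S = 1"
    and m: "\<And>i. i \<in> S \<Longrightarrow> f i \<in> borel_measurable M"
  shows "(\<integral>\<^sup>+x. (\<Prod>i\<in>S. epow (f i x) (w i)) \<partial>M) \<le> (\<Prod>i\<in>S. epow (\<integral>\<^sup>+x. f i x \<partial>M) (w i))"
proof -
  let ?T = "{i\<in>S. w i \<noteq> 0}"
  have eq: "(\<Prod>i\<in>S. epow (g i) (w i)) = (\<Prod>i\<in>?T. epow (g i) (w i))" for g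
    using S by (intro prod.mono_neutral_right) auto
  have "sum w ?T = sum w S"
    using S by (intro sum.mono_neutral_left) auto
  then show ?thesis
    unfolding eq using S w m
    by (intro nn_integral_Holder_pos) (auto simp: less_le)
qed

lemma nn_integral_Holder2:
  assumes "0 \<le> a" "0 \<le> b" "a + b = 1"
    and [measurable]: "f \<in> borel_measurable M" "g \<in> borel_measurable M"
  shows "(\<integral>\<^sup>+x. epow (f x) a * epow (g x) b \<partial>M) \<le> epow (\<integral>\<^sup>+x. f x \<partial>M) a * epow (\<integral>\<^sup>+x. g x \<partial>M) b"
  using nn_integral_Holder[of "UNIV :: bool set" "\<lambda>i. if i then a else b" "\<lambda>i. if i then f else g" M] assms
  by (simp add: UNIV_bool mult.commute)

lemma measurable_nn_integral_fun_upd: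
  fixes f :: "('i \<Rightarrow> real) \<Rightarrow> ennreal"
  assumes j: "j \<in> I" and [measurable]: "f \<in> borel_measurable (PiM I (\<lambda>_. lborel))"
  shows "(\<lambda>x. \<integral>\<^sup>+t. f (x(j := t)) \<partial>lborel) \<in> borel_measurable (PiM I (\<lambda>_. lborel))"
proof (rule sigma_finite_measure.borel_measurable_nn_integral)
  have "(\<lambda>(x, t). x(j := t)) \<in> measurable (PiM I (\<lambda>_. lborel) \<Otimes>\<^sub>M lborel) (PiM I (\<lambda>_. lborel :: real measure))"
    unfolding case_prod_beta
    using j by (intro measurable_PiM_single') (auto simp: fun_upd_apply space_pair_measure space_PiM PiE_def extensional_def)
  then show "(\<lambda>(x, t). f (x(j := t))) \<in> borel_measurable (PiM I (\<lambda>_. lborel) \<Otimes>\<^sub>M lborel)"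
    by (simp add: case_prod_beta)
qed (rule lborel.sigma_finite_measure_axioms)

text \<open>The inductive step integrates out the coordinate \<open>i\<close> and applies Hoelder's inequality to
  the factors that depend on it.\<close>

lemma nn_integral_gridlines:
  fixes I :: "'i set" and f :: "('i \<Rightarrow> real) \<Rightarrow> ennreal"
  assumes "finite I" "0 \<le> r" "r * (real (card I) - 1) \<le> 1"
    and "f \<in> borel_measurable (PiM I (\<lambda>_. lborel))"
  shows "(\<integral>\<^sup>+x. epow (f x) (1 - (real (card I) - 1) * r) *
            (\<Prod>i\<in>I. epow (\<integral>\<^sup>+t. f (x(i := t)) \<partial>lborel) r) \<partial>PiM I (\<lambda>_. lborel))
         \<le> epow (\<integral>\<^sup>+x. f x \<partial>PiM I (\<lambda>_. lborel)) (1 + r)"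
  using assms
proof (induction I arbitrary: f rule: finite_induct)
  case empty
  then show ?case by (simp add: PiM_empty nn_integral_count_space_finite flip: epow_add)
next
  case (insert i I)
  let ?M = "\<lambda>I. PiM I (\<lambda>_::'i. lborel :: real measure)"
  interpret product_sigma_finite "\<lambda>_::'i. lborel :: real measure"
    by standard
  note [measurable] = \<open>f \<in> borel_measurable (?M (insert i I))\<close>
  have fin: "finite I" and i: "i \<notin> I" using insert by auto
  define k where "k = real (card I)"
  have k: "real (card (insert i I)) = k + 1" "0 \<le> k" using fin i by (auto simp: k_def)
  have r: "0 \<le> r" "k * r \<le> 1" using insert.prems k by (auto simp: mult.commute)
  \<comment> \<open>The line integral in direction \<open>i\<close> does not depend on the
    coordinate \<open>i\<close>, so its power leaves the inner integral as a constant.\<close>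
  define F where "F x = (\<integral>\<^sup>+t. f (x(i := t)) \<partial>lborel)" for x
  have [measurable]: "F \<in> borel_measurable (?M I)"
    unfolding F_def by measurable
  have "(\<integral>\<^sup>+x. epow (f x) (1 - (real (card (insert i I)) - 1) * r) *
            (\<Prod>j\<in>insert i I. epow (\<integral>\<^sup>+t. f (x(j := t)) \<partial>lborel) r) \<partial>?M (insert i I))
      = (\<integral>\<^sup>+x. (\<integral>\<^sup>+y. epow (f (x(i := y))) (1 - k * r) * (epow (F x) r *
            (\<Prod>j\<in>I. epow (\<integral>\<^sup>+t. f (x(i := y, j := t)) \<partial>lborel) r)) \<partial>lborel) \<partial>?M I)"
  proof (subst product_nn_integral_insert)
    show "(\<lambda>x. epow (f x) (1 - (real (card (insert i I)) - 1) * r) *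
        (\<Prod>j\<in>insert i I. epow (\<integral>\<^sup>+t. f (x(j := t)) \<partial>lborel) r)) \<in> borel_measurable (?M (insert i I))"
      by (intro borel_measurable_times_ennreal borel_measurable_prod_ennreal measurable_epow
          measurable_nn_integral_fun_upd) auto
  qed (use fin i in \<open>auto simp: k F_def k_def mult_ac\<close>)
  also have "\<dots> \<le> (\<integral>\<^sup>+x. epow (F x) (1 - (k - 1) * r) *
            (\<Prod>j\<in>I. epow (\<integral>\<^sup>+t. F (x(j := t)) \<partial>lborel) r) \<partial>?M I)"
  proof (rule nn_integral_mono)
    fix x assume x: "x \<in> space (?M I)"
    have m1: "(\<lambda>(y, t). f (x(i := y, j := t))) \<in> borel_measurable (lborel \<Otimes>\<^sub>M lborel)" if "j \<in> I" for j
    proof -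
      have "(\<lambda>(y, t). x(i := y, j := t)) \<in> measurable (lborel \<Otimes>\<^sub>M lborel) (?M (insert i I))"
        using x that by (auto intro!: measurable_PiM_single' simp: space_PiM PiE_def extensional_def case_prod_beta fun_upd_def split: if_split_asm)
      then show ?thesis
        by (simp add: case_prod_beta)
    qed
    have m2: "(\<lambda>y. \<integral>\<^sup>+t. f (x(i := y, j := t)) \<partial>lborel) \<in> borel_measurable lborel" if "j \<in> I" for j
      by (rule sigma_finite_measure.borel_measurable_nn_integral) (use m1[OF that] in \<open>auto intro: lborel.sigma_finite_measure_axioms\<close>)
    \<comment> \<open>The indices of one Hoelder inequality: \<open>None\<close> is \<open>f\<close>
      itself with weight \<open>1 - k * r\<close>, \<open>Some j\<close> is the line integral in
      direction \<open>j\<close> with weight \<open>r\<close>.\<close>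
    define g where "g j y = (case j of None \<Rightarrow> f (x(i := y)) | Some j \<Rightarrow> \<integral>\<^sup>+t. f (x(i := y, j := t)) \<partial>lborel)" for j y
    define w where "w j = (case j of None \<Rightarrow> 1 - k * r | Some j \<Rightarrow> r)" for j :: "'i option"
    let ?S = "insert None (Some ` I)"
    have gN: "g None = (\<lambda>y. f (x(i := y)))" by (auto simp: g_def)
    have pS: "(\<Prod>j\<in>?S. h j) = h None * (\<Prod>j\<in>I. h (Some j))" for h :: "'i option \<Rightarrow> ennreal"
      using fin by (simp add: prod.reindex)
    have sS: "(\<Sum>j\<in>?S. h j) = h None + (\<Sum>j\<in>I. h (Some j))" for h :: "'i option \<Rightarrow> real"
      using fin by (simp add: sum.reindex)
    have H: "(\<integral>\<^sup>+y. (\<Prod>j\<in>?S. epow (g j y) (w j)) \<partial>lborel) \<le> (\<Prod>j\<in>?S. epow (\<integral>\<^sup>+y. g j y \<partial>lborel) (w j))"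
    proof (rule nn_integral_Holder)
      show "sum w ?S = 1" unfolding sS by (simp add: w_def k_def)
    qed (use fin r m2 x in \<open>auto simp: w_def g_def\<close>)
    have fub: "(\<integral>\<^sup>+y. g (Some j) y \<partial>lborel) = (\<integral>\<^sup>+t. F (x(j := t)) \<partial>lborel)" if "j \<in> I" for j
    proof -
      have ij: "x(i := y, j := t) = x(j := t, i := y)" for y t
        using that i by (auto simp: fun_eq_iff)
      show ?thesis
        unfolding g_def F_def option.case
        using lborel_pair.Fubini'[OF m1[OF that]] by (simp add: ij)
    qed
    have "(\<integral>\<^sup>+y. epow (f (x(i := y))) (1 - k * r) * (epow (F x) r *
            (\<Prod>j\<in>I. epow (\<integral>\<^sup>+t. f (x(i := y, j := t)) \<partial>lborel) r)) \<partial>lborel)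
        = epow (F x) r * (\<integral>\<^sup>+y. (\<Prod>j\<in>?S. epow (g j y) (w j)) \<partial>lborel)"
      unfolding pS using x m2
      by (subst nn_integral_cmult[symmetric]) (auto simp: g_def w_def mult_ac intro!: borel_measurable_times_ennreal borel_measurable_prod_ennreal measurable_epow)
    also have "\<dots> \<le> epow (F x) r * (epow (F x) (1 - k * r) * (\<Prod>j\<in>I. epow (\<integral>\<^sup>+t. F (x(j := t)) \<partial>lborel) r))"
      using H unfolding pS gN by (intro mult_left_mono) (auto simp: w_def fub F_def)
    also have "\<dots> = epow (F x) (1 - (k - 1) * r) * (\<Prod>j\<in>I. epow (\<integral>\<^sup>+t. F (x(j := t)) \<partial>lborel) r)"
    proof -
      \<comment> \<open>The power \<open>r\<close> of \<open>F\<close> pulled out before and the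
        power \<open>1 - k * r\<close> from Hoelder's inequality add up to the exponent in the
        induction hypothesis for \<open>F\<close>.\<close>
      have eq: "1 - (k - 1) * r = r + (1 - k * r)" by (simp add: algebra_simps)
      have "epow (F x) (1 - (k - 1) * r) = epow (F x) r * epow (F x) (1 - k * r)"
        unfolding eq using r by (intro epow_add) auto
      then show ?thesis
        by (simp add: mult.assoc)
    qed
    finally show "(\<integral>\<^sup>+y. epow (f (x(i := y))) (1 - k * r) * (epow (F x) r *
            (\<Prod>j\<in>I. epow (\<integral>\<^sup>+t. f (x(i := y, j := t)) \<partial>lborel) r)) \<partial>lborel)
       \<le> epow (F x) (1 - (k - 1) * r) * (\<Prod>j\<in>I. epow (\<integral>\<^sup>+t. F (x(j := t)) \<partial>lborel) r)" .
  qed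
  also have "\<dots> \<le> epow (\<integral>\<^sup>+x. F x \<partial>?M I) (1 + r)"
    unfolding k_def using r k_def
    by (intro insert.IH) (auto simp: algebra_simps)
  also have "(\<integral>\<^sup>+x. F x \<partial>?M I) = (\<integral>\<^sup>+x. f x \<partial>?M (insert i I))"
    using fin i unfolding F_def by (subst product_nn_integral_insert) auto
  finally show ?case .
qed

section \<open>The Sobolev inequality\<close>

lemma epow_mult_nat: "0 \<le> a \<Longrightarrow> epow x (real k * a) = epow x a ^ k"
  by (induction k) (auto simp: distrib_right epow_add)

text \<open>Integrate the derivative of \<open>W\<close> along the line from a point outside the
  support. The right side runs over the whole line, not just up to \<open>s\<close>, so that it does
  not depend on the coordinate in direction \<open>b\<close>.\<close>

lemma nn_integral_line_ge:
  fixes W :: "'a::euclidean_space \<Rightarrow> real"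
  assumes W: "\<And>x. (W has_derivative (\<lambda>h. g x \<bullet> h)) (at x)" "continuous_on UNIV g"
    and bd: "bounded {x. W x \<noteq> 0}" and b: "norm b = 1"
  shows "ennreal \<bar>W (c + s *\<^sub>R b)\<bar> \<le> (\<integral>\<^sup>+t. ennreal (norm (g (c + t *\<^sub>R b))) \<partial>lborel)"
proof -
  obtain R where R: "\<And>x. W x \<noteq> 0 \<Longrightarrow> norm x \<le> R"
    using bd by (auto simp: bounded_iff)
  \<comment> \<open>\<open>norm c\<close> compensates for the base point, so that
    \<open>c + a *\<^sub>R b\<close> has norm above \<open>R\<close>; \<open>\<bar>s\<bar>\<close>
    ensures \<open>a \<le> s\<close>.\<close>
  define a where "a = - (\<bar>R\<bar> + norm c + \<bar>s\<bar> + 1)"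
  have "norm (c + a *\<^sub>R b) \<ge> \<bar>a\<bar> - norm c"
    using norm_triangle_ineq2[of "a *\<^sub>R b" "-c"] b by (simp add: add.commute)
  then have Wa: "W (c + a *\<^sub>R b) = 0"
    using R[of "c + a *\<^sub>R b"] unfolding a_def by fastforce
  have as: "a \<le> s" using norm_ge_zero[of c] unfolding a_def by linarith
  have c1: "continuous_on UNIV (\<lambda>t. g (c + t *\<^sub>R b))"
    by (rule continuous_on_compose2[OF W(2)]) (auto intro!: continuous_intros)
  have d: "((\<lambda>t. W (c + t *\<^sub>R b)) has_vector_derivative g (c + t *\<^sub>R b) \<bullet> b) (at t within {a..s})" for t
  proof -
    have "((\<lambda>t. c + t *\<^sub>R b) has_derivative (\<lambda>h. h *\<^sub>R b)) (at t within {a..s})"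
      by (auto intro!: derivative_eq_intros)
    from has_derivative_compose[OF this W(1)[of "c + t *\<^sub>R b"]] show ?thesis
      by (simp add: has_vector_derivative_def)
  qed
  have F: "((\<lambda>t. g (c + t *\<^sub>R b) \<bullet> b) has_integral W (c + s *\<^sub>R b)) {a..s}"
    using fundamental_theorem_of_calculus[OF as d] Wa by simp
  have N: "(\<lambda>t. norm (g (c + t *\<^sub>R b))) integrable_on {a..s}"
    by (intro integrable_continuous_real continuous_intros continuous_on_subset[OF c1]) auto
  have "\<bar>W (c + s *\<^sub>R b)\<bar> = norm (integral {a..s} (\<lambda>t. g (c + t *\<^sub>R b) \<bullet> b))"
    using F by (simp add: integral_unique)
  also have "\<dots> \<le> integral {a..s} (\<lambda>t. norm (g (c + t *\<^sub>R b)))"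
    using F N
    by (intro integral_norm_bound_integral) (auto intro: has_integral_integrable order_trans[OF Cauchy_Schwarz_ineq2] simp: b)
  finally have "ennreal \<bar>W (c + s *\<^sub>R b)\<bar> \<le> ennreal (integral {a..s} (\<lambda>t. norm (g (c + t *\<^sub>R b))))"
    by (rule ennreal_leI)
  also have "\<dots> = (\<integral>\<^sup>+t\<in>{a..s}. ennreal (norm (g (c + t *\<^sub>R b))) \<partial>lborel)"
    by (rule nn_integral_has_integral_lebesgue'[symmetric]) (use N in \<open>auto intro: integrable_integral\<close>)
  also have "\<dots> \<le> (\<integral>\<^sup>+t. ennreal (norm (g (c + t *\<^sub>R b))) \<partial>lborel)"
    by (rule nn_integral_mono) (auto simp: indicator_def)
  finally show ?thesis .
qed

text \<open>Split |W|^(n/(n-1)) into n factors |W|^(1/(n-1)), bound each by the line integral of |g|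
  in a different coordinate direction and apply \<open>nn_integral_gridlines\<close> with r =
  1/(n-1), the largest admissible value; the first factor there then has exponent 0.\<close>

lemma Gagliardo_Nirenberg:
  fixes W :: "'a::euclidean_space \<Rightarrow> real"
  defines "n \<equiv> real DIM('a)"
  assumes n: "2 \<le> DIM('a)"
    and W: "\<And>x. (W has_derivative (\<lambda>h. g x \<bullet> h)) (at x)" "continuous_on UNIV g"
    and bd: "bounded {x. W x \<noteq> 0}"
  shows "(\<integral>\<^sup>+x. epow (ennreal \<bar>W x\<bar>) (n / (n - 1)) \<partial>lborel)
    \<le> epow (\<integral>\<^sup>+x. ennreal (norm (g x)) \<partial>lborel) (n / (n - 1))"
proof -
  define r where "r = 1 / (n - 1)"
  have n2: "n \<ge> 2" using n by (simp add: n_def)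
  then have r: "0 \<le> r" "r * (n - 1) = 1" "n / (n - 1) = 1 + r" "n / (n - 1) = n * r"
    by (auto simp: r_def field_simps)
  \<comment> \<open>\<open>T\<close> assembles a point from its coordinates: it carries the product
    measure to \<open>lborel\<close>, and updating the coordinate \<open>b\<close> moves the point
    along a line in direction \<open>b\<close>.\<close>
  define T where "T f = (\<Sum>b\<in>Basis. f b *\<^sub>R b)" for f :: "'a \<Rightarrow> real"
  let ?M = "PiM Basis (\<lambda>_::'a. lborel :: real measure)"
  have T[measurable]: "T \<in> borel_measurable ?M"
    unfolding T_def by measurable
  have L: "(lborel :: 'a measure) = distr ?M borel T"
    unfolding T_def by (rule lborel_eq)
  have gm[measurable]: "g \<in> borel_measurable borel"
    using W(2) by (rule borel_measurable_continuous_onI)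
  have "continuous_on UNIV W"
    using W(1) by (meson continuous_at_imp_continuous_on has_derivative_continuous)
  then have Wm[measurable]: "W \<in> borel_measurable borel"
    by (rule borel_measurable_continuous_onI)
  have Tup: "T (f(b := t)) = T (f(b := 0)) + t *\<^sub>R b" if "b \<in> Basis" for f b t
  proof -
    have "T (f(b := t)) = t *\<^sub>R b + (\<Sum>c\<in>Basis - {b}. f c *\<^sub>R c)" for t
      unfolding T_def sum.remove[OF finite_Basis that] by (auto intro!: sum.cong)
    then show ?thesis by simp
  qed
  have le: "ennreal \<bar>W (T f)\<bar> \<le> (\<integral>\<^sup>+t. ennreal (norm (g (T (f(b := t))))) \<partial>lborel)" if "b \<in> Basis" for f b
  proof -
    define c where "c = T (f(b := 0))"
    have e: "T (f(b := t)) = c + t *\<^sub>R b" for t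
      unfolding c_def by (rule Tup[OF that])
    have "T f = c + f b *\<^sub>R b"
      using e[of "f b"] by (simp only: fun_upd_triv)
    then show ?thesis
      using nn_integral_line_ge[OF W bd, of b c "f b"] that by (simp only: e norm_Basis)
  qed
  have "(\<integral>\<^sup>+x. epow (ennreal \<bar>W x\<bar>) (n / (n - 1)) \<partial>lborel)
      = (\<integral>\<^sup>+f. epow (ennreal \<bar>W (T f)\<bar>) (n / (n - 1)) \<partial>?M)"
    unfolding L by (rule nn_integral_distr) measurable
  also have "\<dots> \<le> (\<integral>\<^sup>+f. epow (ennreal (norm (g (T f)))) (1 - (n - 1) * r) *
      (\<Prod>b\<in>Basis. epow (\<integral>\<^sup>+t. ennreal (norm (g (T (f(b := t))))) \<partial>lborel) r) \<partial>?M)"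
  proof (rule nn_integral_mono)
    fix f
    have "epow (ennreal \<bar>W (T f)\<bar>) (n / (n - 1)) = (\<Prod>b\<in>(Basis::'a set). epow (ennreal \<bar>W (T f)\<bar>) r)"
      using r by (simp add: n_def epow_mult_nat)
    also have "\<dots> \<le> (\<Prod>b\<in>Basis. epow (\<integral>\<^sup>+t. ennreal (norm (g (T (f(b := t))))) \<partial>lborel) r)"
      by (rule prod_mono_ennreal) (intro epow_mono r le)
    finally show "epow (ennreal \<bar>W (T f)\<bar>) (n / (n - 1)) \<le> epow (ennreal (norm (g (T f)))) (1 - (n - 1) * r) *
      (\<Prod>b\<in>Basis. epow (\<integral>\<^sup>+t. ennreal (norm (g (T (f(b := t))))) \<partial>lborel) r)"
      using r by (simp add: mult.commute)
  qed
  also have "\<dots> \<le> epow (\<integral>\<^sup>+f. ennreal (norm (g (T f))) \<partial>?M) (1 + r)"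
    unfolding n_def using r by (intro nn_integral_gridlines) (auto simp: n_def)
  also have "(\<integral>\<^sup>+f. ennreal (norm (g (T f))) \<partial>?M) = (\<integral>\<^sup>+x. ennreal (norm (g x)) \<partial>lborel)"
    unfolding L by (rule nn_integral_distr[symmetric]) measurable
  finally show ?thesis using r by simp
qed

section \<open>Powers of the absolute value and continuous functions with bounded support\<close>

lemma has_real_derivative_abs_powr:
  assumes "1 < a"
  shows "((\<lambda>t. \<bar>t\<bar> powr a) has_real_derivative a * (\<bar>t\<bar> powr (a - 1) * sgn t)) (at t)"
proof -
  consider "t > 0" | "t < 0" | "t = 0" by linarith
  then show ?thesis
  proof cases
    case 1
    have "((\<lambda>t. t powr a) has_real_derivative a * (\<bar>t\<bar> powr (a - 1) * sgn t)) (at t)"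
      using 1 by (auto intro!: derivative_eq_intros)
    then show ?thesis
      by (rule has_field_derivative_transform_within[where d = t]) (use 1 in \<open>auto simp: dist_real_def\<close>)
  next
    case 2
    have "((\<lambda>t. (- t) powr a) has_real_derivative a * (\<bar>t\<bar> powr (a - 1) * sgn t)) (at t)"
      using 2 by (auto intro!: derivative_eq_intros)
    then show ?thesis
      by (rule has_field_derivative_transform_within[where d = "- t"]) (use 2 in \<open>auto simp: dist_real_def\<close>)
  next
    \<comment> \<open>At 0 the difference quotient has modulus |h|^(a-1), which tends to 0 because a
      > 1.\<close>
    case 3
    have "((\<lambda>h. \<bar>h\<bar> powr (a - 1)) \<longlongrightarrow> 0) (at (0::real))"
      using assms by (auto intro!: tendsto_eq_intros)
    then have "((\<lambda>h. \<bar>h\<bar> powr a / h) \<longlongrightarrow> 0) (at (0::real))"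
      by (rule Lim_transform_bound[rotated]) (auto simp: eventually_at_filter powr_diff)
    then show ?thesis
      using 3 by (simp add: DERIV_def)
  qed
qed

lemma continuous_abs_powr_sgn:
  assumes "0 < a"
  shows "continuous_on UNIV (\<lambda>t::real. \<bar>t\<bar> powr a * sgn t)"
proof -
  have "isCont (\<lambda>t::real. \<bar>t\<bar> powr a * sgn t) t" for t
  proof (cases "t = 0")
    case False
    then show ?thesis
      by (intro continuous_intros) auto
  next
    case True
    have "((\<lambda>h. \<bar>h\<bar> powr a) \<longlongrightarrow> 0) (at (0::real))"
      using assms by (auto intro!: tendsto_eq_intros)
    then have "((\<lambda>h. \<bar>h\<bar> powr a * sgn h) \<longlongrightarrow> 0) (at (0::real))"
      by (rule Lim_transform_bound[rotated]) (auto simp: eventually_at_filter abs_mult abs_sgn_eq)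
    then show ?thesis using True by (simp add: isCont_def)
  qed
  then show ?thesis
    by (simp add: continuous_at_imp_continuous_on)
qed

lemma integrable_continuous_bounded_support:
  fixes f :: "'a::euclidean_space \<Rightarrow> real"
  assumes "continuous_on UNIV f" "bounded {x. f x \<noteq> 0}"
  shows "integrable lborel f"
proof -
  obtain R where R: "\<And>x. f x \<noteq> 0 \<Longrightarrow> norm x \<le> R"
    using assms(2) by (auto simp: bounded_iff)
  have "integrable lborel (\<lambda>x. indicator (cball 0 R) x *\<^sub>R f x)"
    by (rule borel_integrable_compact) (auto intro: continuous_on_subset[OF assms(1)])
  also have "(\<lambda>x. indicator (cball 0 R) x *\<^sub>R f x) = f"
    using R by (fastforce simp: fun_eq_iff indicator_def)
  finally show ?thesis .
qed

lemma continuous_norm_powr: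
  fixes f :: "'a::topological_space \<Rightarrow> 'b::real_normed_vector"
  assumes "continuous_on S f" "0 < a"
  shows "continuous_on S (\<lambda>x. norm (f x) powr a)"
  using assms by (intro continuous_on_powr' continuous_intros) auto

text \<open>The p-th power of the usual form: \<open>(n - p) / n\<close> is p divided by the Sobolev
  exponent. Apply \<open>Gagliardo_Nirenberg\<close> to |v|^s; Hoelder's inequality returns a power
  of the integral \<open>A\<close> on the left, and dividing by it leaves the integral of
  |g|^p.\<close>

lemma Sobolev:
  fixes v :: "'a::euclidean_space \<Rightarrow> real"
  defines "n \<equiv> real DIM('a)"
  assumes p: "1 < p" "p < n"
    and v: "\<And>x. (v has_derivative (\<lambda>h. g x \<bullet> h)) (at x)" "continuous_on UNIV g"
    and bd: "bounded {x. v x \<noteq> 0}"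
  shows "(\<integral>x. \<bar>v x\<bar> powr (n * p / (n - p)) \<partial>lborel) powr ((n - p) / n)
    \<le> (p * (n - 1) / (n - p)) powr p * (\<integral>x. norm (g x) powr p \<partial>lborel)"
proof -
  \<comment> \<open>Determined by s n/(n-1) = \<open>ps\<close>. Then also (s-1) p/(p-1) =
    \<open>ps\<close>, which is why Hoelder's inequality brings \<open>A\<close> back.\<close>
  define s where "s = p * (n - 1) / (n - p)"
  define ps where "ps = n * p / (n - p)"
  define A where "A = (\<integral>x. \<bar>v x\<bar> powr ps \<partial>lborel)"
  define B where "B = (\<integral>x. norm (g x) powr p \<partial>lborel)"
  have n: "2 \<le> DIM('a)"
    using p unfolding n_def by linarith
  have s: "1 < s" "s - 1 = ps * (1 - 1 / p)" "s * (n / (n - 1)) = ps" "0 < ps"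
  proof -
    show "1 < s" "s - 1 = ps * (1 - 1 / p)" "0 < ps"
      using p by (auto simp: s_def ps_def field_simps)
    have "n - 1 \<noteq> 0" using p by simp
    then show "s * (n / (n - 1)) = ps" by (simp add: s_def ps_def)
  qed
  have cv: "continuous_on UNIV v"
    using v(1) by (meson continuous_at_imp_continuous_on has_derivative_continuous)
  \<comment> \<open>Makes |g|^p a continuous function with bounded support, so that \<open>B\<close>
    is finite.\<close>
  have g0: "g x = 0" if "x \<notin> closure {x. v x \<noteq> 0}" for x
  proof -
    have "((\<lambda>x. 0) has_derivative (\<lambda>h. g x \<bullet> h)) (at x)"
      by (rule has_derivative_transform_within_open[OF v(1), of "- closure {x. v x \<noteq> 0}"])
        (use that closure_subset[of "{x. v x \<noteq> 0}"] in auto)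
    then have "(\<lambda>h. g x \<bullet> h) = (\<lambda>h. 0)"
      by (rule has_derivative_unique) (rule has_derivative_const)
    then show ?thesis by (metis inner_eq_zero_iff)
  qed
  have iA: "integrable lborel (\<lambda>x. \<bar>v x\<bar> powr ps)"
    by (rule integrable_continuous_bounded_support)
      (use s in \<open>auto intro!: continuous_norm_powr[where 'b = real, simplified] cv bounded_subset[OF bd]\<close>)
  have iB: "integrable lborel (\<lambda>x. norm (g x) powr p)"
    by (rule integrable_continuous_bounded_support)
      (use p g0 in \<open>auto intro!: continuous_norm_powr v(2) bounded_subset[OF bounded_closure[OF bd]]\<close>)
  have [measurable]: "v \<in> borel_measurable borel" "g \<in> borel_measurable borel"
    using cv v(2) by (auto intro: borel_measurable_continuous_onI)
  have A: "0 \<le> A" and B: "0 \<le> B" by (auto simp: A_def B_def)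
  have nA: "(\<integral>\<^sup>+x. ennreal (\<bar>v x\<bar> powr ps) \<partial>lborel) = ennreal A"
    unfolding A_def by (rule nn_integral_eq_integral[OF iA]) auto
  have nB: "(\<integral>\<^sup>+x. ennreal (norm (g x) powr p) \<partial>lborel) = ennreal B"
    unfolding B_def by (rule nn_integral_eq_integral[OF iB]) auto
  define gW where "gW x = (s * (\<bar>v x\<bar> powr (s - 1) * sgn (v x))) *\<^sub>R g x" for x
  have W: "((\<lambda>x. \<bar>v x\<bar> powr s) has_derivative (\<lambda>h. gW x \<bullet> h)) (at x)" for x
    using DERIV_compose_FDERIV[OF has_real_derivative_abs_powr[OF s(1)] v(1)[of x]]
    by (simp add: gW_def mult_ac)
  have cW: "continuous_on UNIV gW"
    unfolding gW_def
    by (intro continuous_intros v(2) continuous_on_compose2[OF continuous_abs_powr_sgn cv]) (use s in auto)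
  have "ennreal A = (\<integral>\<^sup>+x. epow (ennreal \<bar>\<bar>v x\<bar> powr s\<bar>) (n / (n - 1)) \<partial>lborel)"
    unfolding nA[symmetric] using p s(3) by (intro nn_integral_cong) (simp add: epow_ennreal powr_powr)
  also have "\<dots> \<le> epow (\<integral>\<^sup>+x. ennreal (norm (gW x)) \<partial>lborel) (n / (n - 1))"
    unfolding n_def by (rule Gagliardo_Nirenberg[OF n W cW]) (use s in \<open>auto intro!: bounded_subset[OF bd]\<close>)
  also have "(\<integral>\<^sup>+x. ennreal (norm (gW x)) \<partial>lborel)
      = (\<integral>\<^sup>+x. ennreal s * (epow (ennreal (\<bar>v x\<bar> powr ps)) (1 - 1 / p) * epow (ennreal (norm (g x) powr p)) (1 / p)) \<partial>lborel)"
  proof (rule nn_integral_cong)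
    fix x
    have "norm (gW x) = s * (\<bar>v x\<bar> powr (s - 1) * norm (g x))"
      using s by (auto simp: gW_def abs_mult abs_sgn_eq)
    also have "\<dots> = s * ((\<bar>v x\<bar> powr ps) powr (1 - 1 / p) * (norm (g x) powr p) powr (1 / p))"
      using p s(2) by (simp add: powr_powr)
    finally show "ennreal (norm (gW x)) = ennreal s * (epow (ennreal (\<bar>v x\<bar> powr ps)) (1 - 1 / p) * epow (ennreal (norm (g x) powr p)) (1 / p))"
      using p s by (simp add: epow_ennreal ennreal_mult)
  qed
  also have "\<dots> = ennreal s * (\<integral>\<^sup>+x. (epow (ennreal (\<bar>v x\<bar> powr ps)) (1 - 1 / p) * epow (ennreal (norm (g x) powr p)) (1 / p)) \<partial>lborel)"
    by (intro nn_integral_cmult) measurable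
  also have "\<dots> \<le> ennreal s * (epow (ennreal A) (1 - 1 / p) * epow (ennreal B) (1 / p))"
    unfolding nA[symmetric] nB[symmetric]
    using p by (intro mult_left_mono nn_integral_Holder2) auto
  also have "\<dots> = ennreal (s * (A powr (1 - 1 / p) * B powr (1 / p)))"
    using s p A B by (simp add: epow_ennreal ennreal_mult)
  finally have "ennreal A \<le> epow (ennreal (s * (A powr (1 - 1 / p) * B powr (1 / p)))) (n / (n - 1))"
    using p by (simp add: epow_mono)
  also have "\<dots> = ennreal ((s * (A powr (1 - 1 / p) * B powr (1 / p))) powr (n / (n - 1)))"
    using p s A B by (intro epow_ennreal) auto
  finally have le: "A \<le> (s * (A powr (1 - 1 / p) * B powr (1 / p))) powr (n / (n - 1))"
    by simp
  \<comment> \<open>The power p (n-1)/n turns the outer exponent n/(n-1) into p. As \<open>A\<close>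
    is finite, its power p-1 can be divided out once \<open>A\<close> is not 0.\<close>
  have "A powr ((n - p) / n) \<le> s powr p * B"
  proof (cases "A = 0")
    case True
    then show ?thesis using p s B by simp
  next
    case False
    with A have A: "0 < A" by simp
    have "A powr (p * (n - 1) / n) \<le> ((s * (A powr (1 - 1 / p) * B powr (1 / p))) powr (n / (n - 1))) powr (p * (n - 1) / n)"
      using le A p by (intro powr_mono2) auto
    also have "\<dots> = (s * (A powr (1 - 1 / p) * B powr (1 / p))) powr p"
      using p by (simp add: powr_powr)
    also have "\<dots> = (s powr p * B) * A powr (p - 1)"
    proof -
      have e: "(1 - 1 / p) * p = p - 1" using p by (simp add: field_simps)
      have "(A powr (1 - 1 / p)) powr p = A powr (p - 1)"
        by (simp only: powr_powr e)
      moreover have "(B powr (1 / p)) powr p = B"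
        using p B by (simp add: powr_powr)
      ultimately show ?thesis by (simp add: powr_mult mult_ac)
    qed
    finally have "A powr (p * (n - 1) / n) / A powr (p - 1) \<le> s powr p * B"
      using A by (simp add: field_simps)
    also have "A powr (p * (n - 1) / n) / A powr (p - 1) = A powr ((n - p) / n)"
    proof -
      have e: "(n - p) / n = p * (n - 1) / n - (p - 1)" using p by (simp add: field_simps)
      show ?thesis unfolding e by (simp add: powr_diff)
    qed
    finally show ?thesis .
  qed
  then show ?thesis
    unfolding A_def B_def ps_def s_def .
qed

section \<open>Smooth functions of test functions\<close>

text \<open>For products and powers, whose derivatives contain undifferentiated factors.\<close>

lemma C_k_SucD: "C_k (Suc k) f \<Longrightarrow> C_k k f"
proof (induction k arbitrary: f)
  case 0
  then show ?case by (simp add: differentiable_imp_continuous_on)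
next
  case (Suc k)
  show ?case
    unfolding C_k.simps(2)[of k]
  proof (intro conjI ballI)
    show "f differentiable_on UNIV" using Suc.prems by simp
    fix b :: 'a assume "b \<in> Basis"
    then have "C_k (Suc k) (\<lambda>x. frechet_derivative f (at x) b)"
      using Suc.prems unfolding C_k.simps(2)[of "Suc k"] by blast
    then show "C_k k (\<lambda>x. frechet_derivative f (at x) b)"
      by (rule Suc.IH)
  qed
qed

text \<open>\<open>C_k\<close> is phrased with \<open>frechet_derivative\<close>. By uniqueness of
  the derivative any explicit one may be used, so that the inductions below only have to apply
  differentiation rules.\<close>

lemma C_k_SucI:
  assumes "\<And>x. (f has_derivative D x) (at x)" "\<And>b. b \<in> Basis \<Longrightarrow> C_k k (\<lambda>x. D x b)"
  shows "C_k (Suc k) f"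
proof -
  have "frechet_derivative f (at x) = D x" for x
    using frechet_derivative_at[OF assms(1)] by simp
  then show ?thesis
    using assms by (auto simp: differentiable_on_def differentiable_def)
qed

lemma C_k_SucE:
  assumes "C_k (Suc k) f"
  obtains D where "\<And>x. (f has_derivative D x) (at x)" "\<And>b. b \<in> Basis \<Longrightarrow> C_k k (\<lambda>x. D x b)"
proof (rule that)
  show "(f has_derivative frechet_derivative f (at x)) (at x)" for x
    using assms by (simp add: differentiable_on_def frechet_derivative_works)
qed (use assms in simp)

lemma C_k_const: "C_k k (\<lambda>x. c)"
proof (induction k arbitrary: c)
  case (Suc k)
  show ?case by (rule C_k_SucI[OF has_derivative_const Suc.IH])
qed simp

lemma C_k_add: "C_k k f \<Longrightarrow> C_k k g \<Longrightarrow> C_k k (\<lambda>x. f x + g x)"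
proof (induction k arbitrary: f g)
  case (Suc k)
  obtain D where D: "\<And>x. (f has_derivative D x) (at x)" "\<And>b. b \<in> Basis \<Longrightarrow> C_k k (\<lambda>x. D x b)"
    using C_k_SucE[OF Suc.prems(1)] by blast
  obtain E where E: "\<And>x. (g has_derivative E x) (at x)" "\<And>b. b \<in> Basis \<Longrightarrow> C_k k (\<lambda>x. E x b)"
    using C_k_SucE[OF Suc.prems(2)] by blast
  show ?case
    by (rule C_k_SucI[OF has_derivative_add[OF D(1) E(1)] Suc.IH[OF D(2) E(2)]])
qed (simp add: continuous_on_add)

lemma C_k_mult: "C_k k f \<Longrightarrow> C_k k g \<Longrightarrow> C_k k (\<lambda>x. f x * g x)"
proof (induction k arbitrary: f g)
  case (Suc k)
  obtain D where D: "\<And>x. (f has_derivative D x) (at x)" "\<And>b. b \<in> Basis \<Longrightarrow> C_k k (\<lambda>x. D x b)"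
    using C_k_SucE[OF Suc.prems(1)] by blast
  obtain E where E: "\<And>x. (g has_derivative E x) (at x)" "\<And>b. b \<in> Basis \<Longrightarrow> C_k k (\<lambda>x. E x b)"
    using C_k_SucE[OF Suc.prems(2)] by blast
  have fg: "C_k k f" "C_k k g" using Suc.prems by (auto intro: C_k_SucD simp del: C_k.simps)
  show ?case
    by (rule C_k_SucI[OF has_derivative_mult[OF D(1) E(1)]])
       (intro C_k_add Suc.IH fg D(2) E(2))
qed (simp add: continuous_on_mult)

lemma C_k_power: "C_k k f \<Longrightarrow> C_k k (\<lambda>x. f x ^ n)"
  by (induction n) (auto intro: C_k_const C_k_mult)

text \<open>The exponent varies in the induction because differentiation lowers it by 1; positivity
  of \<open>f\<close> makes negative exponents harmless.\<close>

lemma C_k_powr: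
  assumes "C_k k f" "\<And>x. 0 < f x"
  shows "C_k k (\<lambda>x. f x powr a)"
  using assms(1)
proof (induction k arbitrary: a)
  case 0
  then show ?case
    using assms(2) by (auto intro!: continuous_intros simp: less_imp_neq[THEN not_sym])
next
  case (Suc k)
  obtain D where D: "\<And>x. (f has_derivative D x) (at x)" "\<And>b. b \<in> Basis \<Longrightarrow> C_k k (\<lambda>x. D x b)"
    using C_k_SucE[OF Suc.prems] by blast
  have f: "C_k k f" using Suc.prems by (rule C_k_SucD)
  have "((\<lambda>x. f x powr a) has_derivative (\<lambda>h. a * f x powr (a - 1) * D x h)) (at x)" for x
  proof -
    have "((\<lambda>t. t powr a) has_real_derivative a * f x powr (a - 1)) (at (f x))"
      using assms(2)[of x] by (auto intro!: derivative_eq_intros)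
    from DERIV_compose_FDERIV[OF this D(1)] show ?thesis
      by (simp add: mult_ac)
  qed
  then show ?case
    by (rule C_k_SucI) (intro C_k_mult C_k_const Suc.IH[OF f] D(2))
qed

lemma grad_eqI:
  assumes "(f has_derivative (\<lambda>h. g \<bullet> h)) (at x)"
  shows "grad f x = g"
  using frechet_derivative_at[OF assms, symmetric] by (simp add: grad_def euclidean_representation)

lemma has_derivative_grad:
  assumes "C_k (Suc 0) f"
  shows "(f has_derivative (\<lambda>h. grad f x \<bullet> h)) (at x)"
proof -
  have D: "(f has_derivative frechet_derivative f (at x)) (at x)"
    using assms by (simp add: differentiable_on_def frechet_derivative_works)
  have "frechet_derivative f (at x) h = grad f x \<bullet> h" for h
  proof -
    interpret linear "frechet_derivative f (at x)" using D by (rule has_derivative_linear)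
    have "frechet_derivative f (at x) h = frechet_derivative f (at x) (\<Sum>b\<in>Basis. (h \<bullet> b) *\<^sub>R b)"
      by (simp add: euclidean_representation)
    also have "\<dots> = grad f x \<bullet> h"
      unfolding sum scale by (simp add: grad_def inner_sum_left inner_commute[of h] mult.commute)
    finally show ?thesis .
  qed
  with D show ?thesis by (simp add: has_derivative_eq_rhs fun_eq_iff)
qed

lemma continuous_on_grad:
  assumes "C_k (Suc 0) f"
  shows "continuous_on UNIV (grad f)"
  unfolding grad_def using assms by (auto intro!: continuous_intros)

text \<open>One family for both \<open>psi\<close> and \<open>Psi\<close>. For 0 < e \<le> 1 it is
  of order |t|^\<alpha> at 0, |t|^(\<alpha>-2a) for 1 \<le> |t| \<le> e^(-1/2), and
  |t|^(\<alpha>-2a-2b) beyond. The last two factors are powers of smooth functions that are at least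
  1, hence smooth themselves, which a cut-off by cases would not be.\<close>

definition wt :: "real \<Rightarrow> real \<Rightarrow> real \<Rightarrow> real \<Rightarrow> real \<Rightarrow> real" where
  "wt \<alpha> a b e t = \<bar>t\<bar> powr \<alpha> * (1 + t\<^sup>2) powr (- a) * (1 + e * t\<^sup>2) powr (- b)"

definition wt' :: "real \<Rightarrow> real \<Rightarrow> real \<Rightarrow> real \<Rightarrow> real \<Rightarrow> real" where
  "wt' \<alpha> a b e t = \<alpha> * (\<bar>t\<bar> powr (\<alpha> - 1) * sgn t) * (1 + t\<^sup>2) powr (- a) * (1 + e * t\<^sup>2) powr (- b)
     + \<bar>t\<bar> powr \<alpha> * (- a * (1 + t\<^sup>2) powr (- a - 1) * (2 * t)) * (1 + e * t\<^sup>2) powr (- b)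
     + \<bar>t\<bar> powr \<alpha> * (1 + t\<^sup>2) powr (- a) * (- b * (1 + e * t\<^sup>2) powr (- b - 1) * (2 * e * t))"

lemma one_plus_pos: "0 \<le> e \<Longrightarrow> 0 < 1 + e * (t::real)\<^sup>2" "0 < 1 + (t::real)\<^sup>2"
  by (simp_all add: add_pos_nonneg)

lemma wt_nonneg: "0 \<le> wt \<alpha> a b e t"
  by (simp add: wt_def)

lemma wt_0 [simp]: "wt \<alpha> a b e 0 = 0"
  by (simp add: wt_def)

lemma DERIV_wt:
  assumes "1 < \<alpha>" "0 \<le> e"
  shows "(wt \<alpha> a b e has_real_derivative wt' \<alpha> a b e t) (at t)"
proof -
  have 1: "((\<lambda>t. (1 + t\<^sup>2) powr (- a)) has_real_derivative - a * (1 + t\<^sup>2) powr (- a - 1) * (2 * t)) (at t)"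
    using one_plus_pos(2)[of t] by (auto intro!: derivative_eq_intros)
  have 2: "((\<lambda>t. (1 + e * t\<^sup>2) powr (- b)) has_real_derivative - b * (1 + e * t\<^sup>2) powr (- b - 1) * (2 * e * t)) (at t)"
    using one_plus_pos(1)[OF assms(2), of t] by (auto intro!: derivative_eq_intros)
  have "((\<lambda>t. \<bar>t\<bar> powr \<alpha> * (1 + t\<^sup>2) powr (- a) * (1 + e * t\<^sup>2) powr (- b)) has_real_derivative wt' \<alpha> a b e t) (at t)"
    by (rule DERIV_cong[OF DERIV_mult[OF DERIV_mult[OF has_real_derivative_abs_powr[OF assms(1)] 1] 2]])
       (simp add: wt'_def algebra_simps)
  then show ?thesis by (simp add: wt_def[abs_def])
qed

lemma continuous_wt:
  assumes "1 < \<alpha>" "0 \<le> e"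
  shows "continuous_on UNIV (wt \<alpha> a b e)"
  using DERIV_wt[OF assms] by (meson DERIV_isCont continuous_at_imp_continuous_on)

lemma continuous_wt':
  assumes "1 < \<alpha>" "0 \<le> e"
  shows "continuous_on UNIV (wt' \<alpha> a b e)"
proof -
  have X: "continuous_on UNIV (\<lambda>t::real. (1 + t\<^sup>2) powr c)" for c
    by (intro continuous_on_powr continuous_intros ballI less_imp_neq[OF one_plus_pos(2), THEN not_sym])
  have Y: "continuous_on UNIV (\<lambda>t::real. (1 + e * t\<^sup>2) powr c)" for c
    by (intro continuous_on_powr continuous_intros ballI less_imp_neq[OF one_plus_pos(1)[OF assms(2)], THEN not_sym])
  have A: "continuous_on UNIV (\<lambda>t::real. \<bar>t\<bar> powr \<alpha>)"
    using assms continuous_norm_powr[OF continuous_on_id, of \<alpha> "UNIV :: real set"] by simp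
  have S: "continuous_on UNIV (\<lambda>t::real. \<bar>t\<bar> powr (\<alpha> - 1) * sgn t)"
    using assms by (intro continuous_abs_powr_sgn) simp
  show ?thesis
    unfolding wt'_def[abs_def]
    by (intro continuous_on_add continuous_on_mult continuous_on_const continuous_on_id X Y A S)
qed

text \<open>The logarithmic derivative: t wt'/wt = \<alpha> - 2a t^2/(1 + t^2) - 2b e t^2/(1 + e
  t^2), where both fractions lie between 0 and 1. The constant does not see \<open>e\<close>; the
  uniformity of the final bounds in the truncation starts here.\<close>

lemma abs_wt'_le:
  assumes "0 \<le> \<alpha>" "0 \<le> a" "0 \<le> b" "0 \<le> e"
  shows "\<bar>t\<bar> * \<bar>wt' \<alpha> a b e t\<bar> \<le> (\<alpha> + 2 * a + 2 * b) * wt \<alpha> a b e t"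
proof (cases "t = 0")
  case False
  let ?X = "1 + t\<^sup>2" and ?Y = "1 + e * t\<^sup>2"
  note pos = one_plus_pos(1)[OF assms(4), of t] one_plus_pos(2)[of t]
  have eq: "t * wt' \<alpha> a b e t = wt \<alpha> a b e t * (\<alpha> - 2 * a * (t\<^sup>2 / ?X) - 2 * b * (e * t\<^sup>2 / ?Y))"
  proof -
    have "t * (\<bar>t\<bar> powr (\<alpha> - 1) * sgn t) = \<bar>t\<bar> powr \<alpha>"
      using False by (simp add: powr_diff sgn_if)
    moreover have "?X powr (- a - 1) = ?X powr (- a) / ?X" "?Y powr (- b - 1) = ?Y powr (- b) / ?Y"
      using pos by (simp_all add: powr_diff)
    ultimately show ?thesis
      unfolding wt'_def wt_def by (simp add: algebra_simps power2_eq_square)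
  qed
  have b1: "0 \<le> t\<^sup>2 / ?X" "t\<^sup>2 / ?X \<le> 1" "0 \<le> e * t\<^sup>2 / ?Y" "e * t\<^sup>2 / ?Y \<le> 1"
    using pos assms(4) by (auto simp: divide_le_eq)
  have "\<bar>\<alpha> - 2 * a * (t\<^sup>2 / ?X) - 2 * b * (e * t\<^sup>2 / ?Y)\<bar> \<le> \<alpha> + 2 * a + 2 * b"
  proof -
    define A where "A = t\<^sup>2 / ?X"
    define B where "B = e * t\<^sup>2 / ?Y"
    have "0 \<le> a * A" "a * A \<le> a" "0 \<le> b * B" "b * B \<le> b"
      using b1 assms unfolding A_def[symmetric] B_def[symmetric]
      by (auto intro!: mult_nonneg_nonneg mult_left_le)
    then show ?thesis
      using assms unfolding A_def[symmetric] B_def[symmetric] by linarith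
  qed
  then have "wt \<alpha> a b e t * \<bar>\<alpha> - 2 * a * (t\<^sup>2 / ?X) - 2 * b * (e * t\<^sup>2 / ?Y)\<bar> \<le> wt \<alpha> a b e t * (\<alpha> + 2 * a + 2 * b)"
    by (rule mult_left_mono) (rule wt_nonneg)
  moreover have "\<bar>t\<bar> * \<bar>wt' \<alpha> a b e t\<bar> = wt \<alpha> a b e t * \<bar>\<alpha> - 2 * a * (t\<^sup>2 / ?X) - 2 * b * (e * t\<^sup>2 / ?Y)\<bar>"
    using wt_nonneg[of \<alpha> a b e t] by (metis abs_mult abs_of_nonneg eq)
  ultimately show ?thesis by (simp add: mult.commute)
qed simp

lemma wt_has_derivative:
  assumes "1 < \<alpha>" "0 \<le> e" "C_k (Suc 0) \<phi>"
  shows "((\<lambda>x. wt \<alpha> a b e (\<phi> x)) has_derivative (\<lambda>h. (wt' \<alpha> a b e (\<phi> x) *\<^sub>R grad \<phi> x) \<bullet> h)) (at x)"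
  using DERIV_compose_FDERIV[OF DERIV_wt[OF assms(1,2)] has_derivative_grad[OF assms(3)]]
  by (simp add: mult_ac)

text \<open>The even exponent replaces |\<phi>|^(2m) by the polynomial \<phi>^(2m), so zeros of
  \<phi> do not spoil smoothness; the support cannot grow because \<open>wt\<close> vanishes at
  0.\<close>

lemma wt_test_function:
  assumes \<phi>: "\<phi> \<in> test_functions \<Omega>" and m: "0 < m" and e: "0 \<le> e"
  shows "(\<lambda>x. wt (real (2 * m)) a b e (\<phi> x)) \<in> test_functions \<Omega>"
proof -
  let ?w = "\<lambda>x. wt (real (2 * m)) a b e (\<phi> x)"
  \<comment> \<open>Here m > 0 matters: \<open>0 powr 0\<close> is 0 but \<open>0 ^ 0\<close> is
    1.\<close>
  have w: "?w = (\<lambda>x. \<phi> x ^ (2 * m) * (1 + \<phi> x ^ 2) powr (- a) * (1 + e * \<phi> x ^ 2) powr (- b))"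
    using m by (auto simp: wt_def fun_eq_iff power_even_abs powr_realpow' simp del: of_nat_mult)
  have C: "C_k k \<phi>" for k using \<phi> by (simp add: test_functions_def)
  have "C_k k ?w" for k
    unfolding w by (intro C_k_mult C_k_powr C_k_add C_k_power C C_k_const one_plus_pos e)
  moreover have sub: "closure {x. ?w x \<noteq> 0} \<subseteq> closure {x. \<phi> x \<noteq> 0}"
    by (intro closure_mono) auto
  moreover have "compact (closure {x. \<phi> x \<noteq> 0})" "closure {x. \<phi> x \<noteq> 0} \<subseteq> \<Omega>"
    using \<phi> by (auto simp: test_functions_def)
  ultimately show ?thesis
    unfolding test_functions_def by (auto simp: compact_eq_bounded_closed dest: bounded_subset)
qed

section \<open>Weights\<close>

lemma powr_neg_le_one: "1 \<le> x \<Longrightarrow> 0 \<le> b \<Longrightarrow> x powr (- b) \<le> (1::real)"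
  using powr_mono[of "-b" 0 x] by simp

text \<open>Compare 2 c T with X^(p-2). If it is at most that, the left side is absorbed by X^p / 2;
  otherwise X^2 is bounded by a power of T.\<close>

lemma Young_square:
  fixes X T c p :: real
  assumes "0 < c" "0 < T" "0 \<le> X" "2 < p"
  shows "c * X\<^sup>2 * T \<le> X powr p / 2 + c * (2 * c) powr (2 / (p - 2)) * T powr (p / (p - 2))"
proof (cases "X = 0")
  case True
  then show ?thesis using assms by simp
next
  case False
  with assms have X: "0 < X" by simp
  have Xp: "X powr p = X\<^sup>2 * X powr (p - 2)"
    using X by (simp add: powr_diff)
  show ?thesis
  proof (cases "2 * c * T \<le> X powr (p - 2)")
    case True
    have "X\<^sup>2 * (2 * c * T) \<le> X\<^sup>2 * X powr (p - 2)"
      using True by (intro mult_left_mono) auto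
    then have "c * X\<^sup>2 * T \<le> X powr p / 2"
      unfolding Xp by (simp add: mult_ac)
    also have "\<dots> \<le> X powr p / 2 + c * (2 * c) powr (2 / (p - 2)) * T powr (p / (p - 2))"
      using assms by simp
    finally show ?thesis .
  next
    case False
    have "(X powr (p - 2)) powr (2 / (p - 2)) \<le> (2 * c * T) powr (2 / (p - 2))"
      using False assms by (intro powr_mono2) auto
    moreover have "(X powr (p - 2)) powr (2 / (p - 2)) = X\<^sup>2"
    proof -
      have "p - 2 \<noteq> 0" using assms by simp
      then have "(p - 2) * (2 / (p - 2)) = 2"
        by (simp only: times_divide_eq_right nonzero_mult_div_cancel_left not_False_eq_True)
      then show ?thesis using X by (simp only: powr_powr powr_numeral)
    qed
    ultimately have "X\<^sup>2 \<le> (2 * c) powr (2 / (p - 2)) * T powr (2 / (p - 2))"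
      by (simp only: powr_mult)
    then have "c * T * X\<^sup>2 \<le> c * T * ((2 * c) powr (2 / (p - 2)) * T powr (2 / (p - 2)))"
      using assms by (intro mult_left_mono) auto
    also have "\<dots> = c * (2 * c) powr (2 / (p - 2)) * (T powr 1 * T powr (2 / (p - 2)))"
      using assms by (simp add: mult_ac)
    also have "T powr 1 * T powr (2 / (p - 2)) = T powr (p / (p - 2))"
    proof -
      have e: "p / (p - 2) = 1 + 2 / (p - 2)" using assms by (simp add: field_simps)
      show ?thesis unfolding e by (rule powr_add[symmetric])
    qed
    finally have "c * T * X\<^sup>2 \<le> c * (2 * c) powr (2 / (p - 2)) * T powr (p / (p - 2))" .
    moreover have "c * T * X\<^sup>2 = c * X\<^sup>2 * T" by (simp only: mult_ac)
    ultimately show ?thesis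
      using powr_ge_zero[of X p] by linarith
  qed
qed

text \<open>The parameter \<open>e\<close> truncates the growth \<open>|t|\<^sup>\<gamma>\<close>; it is sent to \<open>0\<close> only at the very end.\<close>

definition psi :: "real \<Rightarrow> real \<Rightarrow> real \<Rightarrow> real \<Rightarrow> real" where
  "psi m \<gamma> e t = wt (2 * m) (m - \<gamma> / 2) (\<gamma> / 2) e t"

definition psi' :: "real \<Rightarrow> real \<Rightarrow> real \<Rightarrow> real \<Rightarrow> real" where
  "psi' m \<gamma> e t = wt' (2 * m) (m - \<gamma> / 2) (\<gamma> / 2) e t"

lemma psi_nonneg: "0 \<le> psi m \<gamma> e t"
  by (simp add: psi_def wt_nonneg)

lemma abs_powr_double: "\<bar>t\<bar> powr (2 * m) = (t\<^sup>2) powr (m::real)"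
  by (metis abs_ge_zero power2_abs powr_numeral powr_powr zero_neq_numeral)

lemma psi_le:
  assumes "0 \<le> \<gamma>" "\<gamma> \<le> 2 * m" "0 \<le> e"
  shows "psi m \<gamma> e t \<le> (1 + t\<^sup>2) powr (\<gamma> / 2) * (1 + e * t\<^sup>2) powr (- (\<gamma> / 2))"
proof -
  have "\<bar>t\<bar> powr (2 * m) * (1 + t\<^sup>2) powr (- (m - \<gamma> / 2)) \<le> (1 + t\<^sup>2) powr m * (1 + t\<^sup>2) powr (- (m - \<gamma> / 2))"
    unfolding abs_powr_double using assms by (intro mult_right_mono powr_mono2) auto
  also have "\<dots> = (1 + t\<^sup>2) powr (\<gamma> / 2)"
    by (simp add: powr_add[symmetric])
  finally show ?thesis
    unfolding psi_def wt_def by (intro mult_right_mono) auto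
qed

lemma psi_le_powr:
  assumes "0 \<le> \<gamma>" "\<gamma> \<le> 2 * m" "0 \<le> e"
  shows "psi m \<gamma> e t \<le> (1 + t\<^sup>2) powr (\<gamma> / 2)"
proof -
  have "(1 + t\<^sup>2) powr (\<gamma> / 2) * (1 + e * t\<^sup>2) powr (- (\<gamma> / 2)) \<le> (1 + t\<^sup>2) powr (\<gamma> / 2) * 1"
    using assms by (intro mult_left_mono powr_neg_le_one) auto
  with psi_le[OF assms, of t] show ?thesis by simp
qed

text \<open>Since e \<le> 1, the quotient (1 + t^2)/(1 + e t^2) is at most 1/e. For \<gamma> > 0 the
  bound blows up as e tends to 0; it serves integrability and the limit along the test functions,
  never a final constant.\<close>

lemma psi_bounded:
  assumes "0 \<le> \<gamma>" "\<gamma> \<le> 2 * m" "0 < e" "e \<le> 1"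
  shows "psi m \<gamma> e t \<le> e powr (- (\<gamma> / 2))"
proof -
  have pos: "0 < 1 + e * t\<^sup>2" "0 < 1 + t\<^sup>2"
    using one_plus_pos(1)[of e t] one_plus_pos(2)[of t] assms by auto
  have "1 + t\<^sup>2 \<le> (1 + e * t\<^sup>2) / e"
    using assms by (simp add: field_simps)
  then have "(1 + t\<^sup>2) powr (\<gamma> / 2) \<le> ((1 + e * t\<^sup>2) / e) powr (\<gamma> / 2)"
    using assms pos by (intro powr_mono2) auto
  also have "\<dots> = (1 + e * t\<^sup>2) powr (\<gamma> / 2) * e powr (- (\<gamma> / 2))"
  proof -
    have "(x / e) powr g = x powr g * e powr (- g)" if "0 < x" for x g
      by (simp add: powr_divide powr_minus_divide)
    then show ?thesis using pos(1) by blast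
  qed
  finally have "(1 + t\<^sup>2) powr (\<gamma> / 2) * (1 + e * t\<^sup>2) powr (- (\<gamma> / 2)) \<le>
      (1 + e * t\<^sup>2) powr (\<gamma> / 2) * e powr (- (\<gamma> / 2)) * (1 + e * t\<^sup>2) powr (- (\<gamma> / 2))"
    by (rule mult_right_mono) auto
  also have "\<dots> = e powr (- (\<gamma> / 2))"
    using pos by (simp add: powr_minus)
  finally show ?thesis
    using psi_le[of \<gamma> m e t] assms by simp
qed

lemma psi_le_small:
  assumes "0 \<le> \<gamma>" "\<gamma> \<le> 2 * m" "0 \<le> e"
  shows "psi m \<gamma> e t \<le> \<bar>t\<bar> powr (2 * m)"
proof -
  have "\<bar>t\<bar> powr (2 * m) * (1 + t\<^sup>2) powr (- (m - \<gamma> / 2)) * (1 + e * t\<^sup>2) powr (- (\<gamma> / 2)) \<le> \<bar>t\<bar> powr (2 * m) * 1 * 1"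
    using assms by (intro mult_mono powr_neg_le_one) auto
  then show ?thesis by (simp add: psi_def wt_def)
qed

text \<open>The contributions 2m, 2m - \<gamma> and \<gamma> of the three factors add up to
  4m.\<close>

lemma abs_psi'_le:
  assumes "0 \<le> \<gamma>" "\<gamma> \<le> 2 * m" "0 \<le> e" "0 \<le> m"
  shows "\<bar>t\<bar> * \<bar>psi' m \<gamma> e t\<bar> \<le> 4 * m * psi m \<gamma> e t"
  using abs_wt'_le[of "2 * m" "m - \<gamma> / 2" "\<gamma> / 2" e t] assms
  unfolding psi_def psi'_def by simp

text \<open>Compactness for |t| \<le> 1, and \<open>abs_psi'_le\<close> with
  \<open>psi_bounded\<close> beyond. Again a bound depending on \<open>e\<close>, for use in a
  limit.\<close>

lemma psi'_bounded:
  assumes "0 \<le> \<gamma>" "\<gamma> \<le> 2 * m" "0 < e" "e \<le> 1" "1 < 2 * m"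
  obtains B where "\<And>t. \<bar>psi' m \<gamma> e t\<bar> \<le> B"
proof -
  have c: "continuous_on {-1..1} (psi' m \<gamma> e)"
    unfolding psi'_def[abs_def] using assms by (intro continuous_on_subset[OF continuous_wt']) auto
  have "bounded (psi' m \<gamma> e ` {-1..1})"
    by (intro compact_imp_bounded compact_continuous_image c) auto
  then have "\<exists>B. \<forall>t\<in>{-1..1}. \<bar>psi' m \<gamma> e t\<bar> \<le> B"
    by (simp add: bounded_iff)
  then obtain B where B: "\<And>t. t \<in> {-1..1} \<Longrightarrow> \<bar>psi' m \<gamma> e t\<bar> \<le> B"
    by blast
  have "\<bar>psi' m \<gamma> e t\<bar> \<le> max B (4 * m * e powr (- (\<gamma> / 2)))" for t
  proof (cases "t \<in> {-1..1}")
    case True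
    then show ?thesis using B by (simp add: le_max_iff_disj)
  next
    case False
    then have "1 * \<bar>psi' m \<gamma> e t\<bar> \<le> \<bar>t\<bar> * \<bar>psi' m \<gamma> e t\<bar>"
      by (intro mult_right_mono) auto
    also have "\<dots> \<le> 4 * m * psi m \<gamma> e t"
      using assms by (intro abs_psi'_le) auto
    also have "\<dots> \<le> 4 * m * e powr (- (\<gamma> / 2))"
      using assms by (intro mult_left_mono psi_bounded) auto
    finally show ?thesis by simp
  qed
  then show ?thesis by (rule that)
qed

text \<open>Here the order of vanishing pays off: for |t| \<le> 1 the product is at most |t|^(2m-r),
  and beyond that the factor (1/|t|)^r is at most 1. Used with r = 1 and r = p/(p-2).\<close>

lemma psi_div_le:
  assumes "0 \<le> \<gamma>" "\<gamma> \<le> 2 * m" "0 \<le> e" "0 \<le> r" "r \<le> 2 * m" "t \<noteq> 0"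
  shows "psi m \<gamma> e t * (1 / \<bar>t\<bar>) powr r \<le> 1 + psi m \<gamma> e t"
proof (cases "\<bar>t\<bar> \<le> 1")
  case True
  have "psi m \<gamma> e t * (1 / \<bar>t\<bar>) powr r \<le> \<bar>t\<bar> powr (2 * m) * (1 / \<bar>t\<bar>) powr r"
    using assms by (intro mult_right_mono psi_le_small) auto
  also have "\<dots> = \<bar>t\<bar> powr (2 * m - r)"
    using assms by (simp add: powr_divide powr_diff)
  also have "\<dots> \<le> 1 powr (2 * m - r)"
    using assms True by (intro powr_mono2) auto
  finally show ?thesis using psi_nonneg[of m \<gamma> e t] by simp
next
  case False
  have "(1 / \<bar>t\<bar>) powr r \<le> 1 powr r"
    using False assms by (intro powr_mono2) auto
  then have "psi m \<gamma> e t * (1 / \<bar>t\<bar>) powr r \<le> psi m \<gamma> e t * 1"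
    by (intro mult_left_mono) (auto simp: psi_nonneg)
  then show ?thesis by simp
qed

text \<open>\<open>X\<close> is the norm of the gradient. \<open>abs_psi'_le\<close> bounds |psi'|
  by a multiple of T psi with T = 1/|t|; \<open>Young_square\<close> trades X^2 T for X^p / 2 and
  T^(p/(p-2)), and \<open>psi_div_le\<close> removes the powers of T. \<open>C\<close> is chosen
  before \<gamma>, e, t and X.\<close>

lemma flux_bound:
  assumes p: "2 < p" and \<beta>: "0 < \<beta>" and m: "1 < 2 * m" "p / (p - 2) \<le> 2 * m"
  obtains C where "0 \<le> C" "\<And>\<gamma> e t X. 0 \<le> \<gamma> \<Longrightarrow> \<gamma> \<le> 2 * m \<Longrightarrow> 0 \<le> e \<Longrightarrow> 0 \<le> X \<Longrightarrow>
     \<beta> * (1 + X) * X * \<bar>psi' m \<gamma> e t\<bar> \<le> X powr p * psi m \<gamma> e t / 2 + C * (1 + psi m \<gamma> e t)"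
proof -
  define K where "K = 4 * m"
  define c where "c = 2 * \<beta> * K"
  define C where "C = c * (2 * c) powr (2 / (p - 2))"
  have K: "0 < K" "0 < c" "0 \<le> C" using m \<beta> by (auto simp: K_def c_def C_def)
  have "\<beta> * (1 + X) * X * \<bar>psi' m \<gamma> e t\<bar> \<le> X powr p * psi m \<gamma> e t / 2 + (\<beta> * K + C) * (1 + psi m \<gamma> e t)"
    if \<gamma>: "0 \<le> \<gamma>" "\<gamma> \<le> 2 * m" and e: "0 \<le> e" and X: "0 \<le> X" for \<gamma> e t X
  proof (cases "t = 0")
    case True
    then have "psi' m \<gamma> e t = 0" by (simp add: psi'_def wt'_def)
    then show ?thesis using K \<beta> X psi_nonneg[of m \<gamma> e t] by simp
  next
    case False
    let ?P = "psi m \<gamma> e t"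
    define T where "T = 1 / \<bar>t\<bar>"
    have T: "0 < T" using False by (simp add: T_def)
    have P': "\<bar>psi' m \<gamma> e t\<bar> \<le> K * T * ?P"
      using abs_psi'_le[OF \<gamma> e, of t] m False by (simp add: T_def K_def field_simps)
    have "(1 + X) * X \<le> 1 + 2 * X\<^sup>2"
      using zero_le_power2[of "X - 1"] X by (simp add: power2_eq_square algebra_simps)
    then have bX: "\<beta> * ((1 + X) * X) \<le> \<beta> * (1 + 2 * X\<^sup>2)"
      using \<beta> by (intro mult_left_mono) auto
    have "\<beta> * (1 + X) * X * \<bar>psi' m \<gamma> e t\<bar> = (\<beta> * ((1 + X) * X)) * \<bar>psi' m \<gamma> e t\<bar>"
      by (simp add: mult.assoc)
    also have "\<dots> \<le> \<beta> * (1 + 2 * X\<^sup>2) * (K * T * ?P)"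
      by (rule mult_mono[OF bX P']) (use \<beta> in auto)
    also have "\<dots> = \<beta> * K * (?P * T powr 1) + ?P * (c * X\<^sup>2 * T)"
      using T by (simp add: c_def algebra_simps)
    also have "\<dots> \<le> \<beta> * K * (1 + ?P) + ?P * (X powr p / 2 + C * T powr (p / (p - 2)))"
    proof (intro add_mono mult_left_mono)
      show "?P * T powr 1 \<le> 1 + ?P"
        unfolding T_def using \<gamma> e m False by (intro psi_div_le) auto
      show "c * X\<^sup>2 * T \<le> X powr p / 2 + C * T powr (p / (p - 2))"
        unfolding C_def using K T X p by (intro Young_square) auto
    qed (use \<beta> K in \<open>auto simp: psi_nonneg\<close>)
    also have "\<dots> = \<beta> * K * (1 + ?P) + X powr p * ?P / 2 + C * (?P * T powr (p / (p - 2)))"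
      by (simp add: algebra_simps)
    also have "\<dots> \<le> \<beta> * K * (1 + ?P) + X powr p * ?P / 2 + C * (1 + ?P)"
      unfolding T_def using \<gamma> e m False K p by (intro add_mono mult_left_mono psi_div_le order_refl) auto
    finally show ?thesis by (simp add: algebra_simps)
  qed
  then show ?thesis
    using K \<beta> by (intro that[of "\<beta> * K + C"]) auto
qed

text \<open>Beyond \<open>R\<close> the power |t|^(p-1) exceeds (C + L)/d; up to \<open>R\<close>
  the weight is bounded independently of \<open>e\<close>. Later \<open>L\<close> is |lam|, and
  \<open>d\<close> is so small that Sobolev's inequality lets the energy absorb the last
  term.\<close>

lemma lower_order_bound:
  assumes p: "1 < p" and C: "0 \<le> C" "0 \<le> L" and d: "0 < d" and \<gamma>: "0 \<le> \<gamma>" "\<gamma> \<le> 2 * m"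
  obtains C' where "0 \<le> C'" "\<And>e t. 0 \<le> e \<Longrightarrow>
    C * (1 + psi m \<gamma> e t) + L * \<bar>t\<bar> * psi m \<gamma> e t \<le> C' + d * (\<bar>t\<bar> powr p * psi m \<gamma> e t)"
proof -
  define R where "R = max 1 (((C + L) / d) powr (1 / (p - 1)))"
  define C' where "C' = C + (C + L * R) * (1 + R\<^sup>2) powr (\<gamma> / 2)"
  have R: "1 \<le> R" "0 \<le> R" by (auto simp: R_def)
  have C'0: "0 \<le> C'" "C \<le> C'" using C R by (auto simp: C'_def)
  have "C * (1 + psi m \<gamma> e t) + L * \<bar>t\<bar> * psi m \<gamma> e t \<le> C' + d * (\<bar>t\<bar> powr p * psi m \<gamma> e t)"
    if e: "0 \<le> e" for e t
  proof (cases "\<bar>t\<bar> \<le> R")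
    case True
    let ?P = "psi m \<gamma> e t"
    have "t\<^sup>2 \<le> R\<^sup>2" using True R by (simp add: abs_le_square_iff[symmetric])
    then have "(1 + t\<^sup>2) powr (\<gamma> / 2) \<le> (1 + R\<^sup>2) powr (\<gamma> / 2)"
      using \<gamma> by (intro powr_mono2) auto
    then have P: "?P \<le> (1 + R\<^sup>2) powr (\<gamma> / 2)"
      using psi_le_powr[OF \<gamma> e, of t] by simp
    have "(C + L * \<bar>t\<bar>) * ?P \<le> (C + L * R) * (1 + R\<^sup>2) powr (\<gamma> / 2)"
      using True P C R psi_nonneg by (intro mult_mono add_mono mult_left_mono) auto
    moreover have "0 \<le> d * (\<bar>t\<bar> powr p * ?P)" using d psi_nonneg[of m \<gamma> e t] by simp
    ultimately show ?thesis by (simp add: C'_def algebra_simps)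
  next
    case False
    let ?P = "psi m \<gamma> e t"
    have t: "1 \<le> \<bar>t\<bar>" "((C + L) / d) powr (1 / (p - 1)) \<le> \<bar>t\<bar>" using False by (auto simp: R_def)
    have "(((C + L) / d) powr (1 / (p - 1))) powr (p - 1) \<le> \<bar>t\<bar> powr (p - 1)"
      using t p by (intro powr_mono2) auto
    then have "(C + L) / d \<le> \<bar>t\<bar> powr (p - 1)"
      using p C d by (simp add: powr_powr)
    then have "C + L \<le> d * \<bar>t\<bar> powr (p - 1)" using d by (simp add: field_simps)
    then have "(C + L) * \<bar>t\<bar> \<le> d * \<bar>t\<bar> powr (p - 1) * \<bar>t\<bar>" by (rule mult_right_mono) auto
    also have "\<dots> = d * \<bar>t\<bar> powr p" using t by (simp add: powr_diff)
    finally have "C * \<bar>t\<bar> + L * \<bar>t\<bar> \<le> d * \<bar>t\<bar> powr p" by (simp add: algebra_simps)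
    moreover have "C * 1 \<le> C * \<bar>t\<bar>" using t C by (intro mult_left_mono) auto
    ultimately have "C + L * \<bar>t\<bar> \<le> d * \<bar>t\<bar> powr p" by simp
    then have "(C + L * \<bar>t\<bar>) * ?P \<le> d * \<bar>t\<bar> powr p * ?P"
      by (rule mult_right_mono) (rule psi_nonneg)
    then show ?thesis using C'0 by (simp add: algebra_simps)
  qed
  then show ?thesis using C'0 by (intro that[of C']) auto
qed

text \<open>For |t| > 1 split psi^q' into psi^(q'-\<kappa>) and psi^\<kappa>; the first factor is at
  most a constant times |t|^(\<gamma> (q'-\<kappa>)) = |t|^(p \<kappa>). Only the upper bound of psi
  by a multiple of |t|^\<gamma> enters, and truncation preserves it.\<close>

lemma psi_powr_le:
  assumes \<gamma>: "0 \<le> \<gamma>" "\<gamma> \<le> 2 * m" and e: "0 \<le> e" and k: "0 < \<kappa>" "\<kappa> \<le> q'" "0 < p"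
    and eq: "\<gamma> * (q' - \<kappa>) = p * \<kappa>"
  shows "psi m \<gamma> e t powr q' \<le> 2 powr (\<gamma> * q' / 2) * (1 + (\<bar>t\<bar> powr p * psi m \<gamma> e t) powr \<kappa>)"
proof -
  let ?P = "psi m \<gamma> e t"
  let ?c = "2 powr (\<gamma> * q' / 2) :: real"
  have P: "0 \<le> ?P" by (rule psi_nonneg)
  show ?thesis
  proof (cases "\<bar>t\<bar> \<le> 1")
    case True
    then have t2: "t\<^sup>2 \<le> 1" by (simp add: abs_square_le_1)
    have "?P \<le> (1 + t\<^sup>2) powr (\<gamma> / 2)" by (rule psi_le_powr[OF \<gamma> e])
    also have "\<dots> \<le> 2 powr (\<gamma> / 2)" using t2 \<gamma> by (intro powr_mono2) auto
    finally have "?P powr q' \<le> (2 powr (\<gamma> / 2)) powr q'" using P k by (intro powr_mono2) auto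
    also have "\<dots> = ?c * 1" by (simp add: powr_powr)
    also have "\<dots> \<le> ?c * (1 + (\<bar>t\<bar> powr p * ?P) powr \<kappa>)"
      by (intro mult_left_mono) auto
    finally show ?thesis .
  next
    case False
    then have "1 \<le> t\<^sup>2"
      using abs_square_le_1[of t] abs_square_less_1[of t] by linarith
    then have t2: "1 + t\<^sup>2 \<le> 2 * t\<^sup>2" by simp
    have t0: "t \<noteq> 0" using False by auto
    have "?P powr (q' - \<kappa>) \<le> ((1 + t\<^sup>2) powr (\<gamma> / 2)) powr (q' - \<kappa>)"
      using psi_le_powr[OF \<gamma> e] P k by (intro powr_mono2) auto
    also have "\<dots> = (1 + t\<^sup>2) powr (\<gamma> * (q' - \<kappa>) / 2)"
      by (simp add: powr_powr)
    also have "\<dots> \<le> (2 * t\<^sup>2) powr (\<gamma> * (q' - \<kappa>) / 2)"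
      using t2 k \<gamma> by (intro powr_mono2) auto
    also have "\<dots> = 2 powr (\<gamma> * (q' - \<kappa>) / 2) * \<bar>t\<bar> powr (2 * (\<gamma> * (q' - \<kappa>) / 2))"
      unfolding abs_powr_double by (simp add: powr_mult)
    also have "\<bar>t\<bar> powr (2 * (\<gamma> * (q' - \<kappa>) / 2)) = (\<bar>t\<bar> powr p) powr \<kappa>"
      by (simp add: eq powr_powr)
    also have "2 powr (\<gamma> * (q' - \<kappa>) / 2) \<le> ?c"
      using \<gamma> k by (intro powr_mono divide_right_mono mult_left_mono) auto
    finally have le: "?P powr (q' - \<kappa>) \<le> ?c * (\<bar>t\<bar> powr p) powr \<kappa>"
      by (simp add: mult_right_mono)
    have "?P powr q' = ?P powr (q' - \<kappa>) * ?P powr \<kappa>"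
      by (simp add: powr_add[symmetric])
    also have "\<dots> \<le> ?c * (\<bar>t\<bar> powr p) powr \<kappa> * ?P powr \<kappa>"
      using le by (rule mult_right_mono) auto
    also have "\<dots> = ?c * (\<bar>t\<bar> powr p * ?P) powr \<kappa>"
      by (simp add: powr_mult)
    also have "\<dots> \<le> ?c * (1 + (\<bar>t\<bar> powr p * ?P) powr \<kappa>)"
      by (intro mult_left_mono) auto
    finally show ?thesis .
  qed
qed

text \<open>From 1 + t^2 \<le> 2 t^2. This lower bound for the untruncated weight converts the
  estimate of |u|^p psi(u) into one of |u|^(p+\<gamma>).\<close>

lemma powr_le_psi_0:
  assumes \<gamma>: "0 \<le> \<gamma>" "\<gamma> \<le> 2 * m" and t: "1 \<le> \<bar>t\<bar>"
  shows "\<bar>t\<bar> powr \<gamma> \<le> 2 powr m * psi m \<gamma> 0 t"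
proof -
  have t1: "1 \<le> t\<^sup>2" using t abs_square_less_1[of t] by linarith
  have pos: "0 < 1 + t\<^sup>2" using t1 by simp
  have "\<bar>t\<bar> powr \<gamma> = (t\<^sup>2) powr (\<gamma> / 2)"
    using abs_powr_double[of t "\<gamma> / 2"] by simp
  also have "\<dots> = (t\<^sup>2) powr m * (t\<^sup>2) powr (- (m - \<gamma> / 2))"
    by (simp add: powr_add[symmetric])
  also have "\<dots> \<le> (t\<^sup>2) powr m * (2 powr (m - \<gamma> / 2) * (1 + t\<^sup>2) powr (- (m - \<gamma> / 2)))"
  proof (intro mult_left_mono)
    have "(1 + t\<^sup>2) powr (m - \<gamma> / 2) \<le> (2 * t\<^sup>2) powr (m - \<gamma> / 2)"
      using t1 \<gamma> by (intro powr_mono2) auto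
    then have "(1 + t\<^sup>2) powr (m - \<gamma> / 2) \<le> 2 powr (m - \<gamma> / 2) * (t\<^sup>2) powr (m - \<gamma> / 2)"
      by (simp add: powr_mult)
    moreover have "inverse B \<le> c * inverse A" if "A \<le> c * B" "0 < A" "0 < B" for A B c :: real
      using that by (simp add: field_simps)
    ultimately show "(t\<^sup>2) powr (- (m - \<gamma> / 2)) \<le> 2 powr (m - \<gamma> / 2) * (1 + t\<^sup>2) powr (- (m - \<gamma> / 2))"
      unfolding powr_minus using t1 pos by force
  qed auto
  also have "\<dots> = 2 powr (m - \<gamma> / 2) * psi m \<gamma> 0 t"
    unfolding psi_def wt_def abs_powr_double by (simp add: mult_ac)
  also have "\<dots> \<le> 2 powr m * psi m \<gamma> 0 t"
    using \<gamma> by (intro mult_right_mono powr_mono psi_nonneg) auto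
  finally show ?thesis .
qed

lemma tendsto_psi_0:
  "((\<lambda>e. psi m \<gamma> e t) \<longlongrightarrow> psi m \<gamma> 0 t) (at_right 0)"
  unfolding psi_def wt_def by (intro tendsto_intros tendsto_eq_intros) auto

section \<open>Hoelder's inequality for real integrals, Lebesgue spaces and test functions\<close>

lemma integral_Holder:
  fixes F G :: "'a \<Rightarrow> real"
  assumes ab: "0 < a" "0 < b" "a + b = 1"
    and F: "integrable M F" "\<And>x. 0 \<le> F x" and G: "integrable M G" "\<And>x. 0 \<le> G x"
  shows integrable_Holder: "integrable M (\<lambda>x. F x powr a * G x powr b)"
    and "(\<integral>x. F x powr a * G x powr b \<partial>M) \<le> (\<integral>x. F x \<partial>M) powr a * (\<integral>x. G x \<partial>M) powr b"
proof -
  have [measurable]: "F \<in> borel_measurable M" "G \<in> borel_measurable M" using F G by auto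
  have I: "0 \<le> integral\<^sup>L M F" "0 \<le> integral\<^sup>L M G"
    using F(2) G(2) by (auto intro: integral_nonneg_AE)
  have "(\<integral>\<^sup>+x. ennreal (F x powr a * G x powr b) \<partial>M) = (\<integral>\<^sup>+x. epow (ennreal (F x)) a * epow (ennreal (G x)) b \<partial>M)"
    using ab F(2) G(2) by (intro nn_integral_cong) (simp add: epow_ennreal ennreal_mult)
  also have "\<dots> \<le> epow (\<integral>\<^sup>+x. F x \<partial>M) a * epow (\<integral>\<^sup>+x. G x \<partial>M) b"
    using ab by (intro nn_integral_Holder2) auto
  also have "\<dots> = ennreal (integral\<^sup>L M F powr a * integral\<^sup>L M G powr b)"
    using ab F G I by (simp add: nn_integral_eq_integral epow_ennreal ennreal_mult)
  finally have le: "(\<integral>\<^sup>+x. ennreal (F x powr a * G x powr b) \<partial>M) \<le> ennreal (integral\<^sup>L M F powr a * integral\<^sup>L M G powr b)" .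
  show int: "integrable M (\<lambda>x. F x powr a * G x powr b)"
    using le by (intro integrableI_nonneg) (auto simp: top_unique intro: le_less_trans)
  show "(\<integral>x. F x powr a * G x powr b \<partial>M) \<le> (\<integral>x. F x \<partial>M) powr a * (\<integral>x. G x \<partial>M) powr b"
    using le by (simp add: nn_integral_eq_integral[OF int])
qed

lemma norm_add_powr_le:
  fixes x y :: "'a::real_normed_vector"
  assumes "0 \<le> p"
  shows "norm (x + y) powr p \<le> 2 powr p * (norm x powr p + norm y powr p)"
proof -
  have "norm (x + y) \<le> 2 * max (norm x) (norm y)"
    using norm_triangle_ineq[of x y] by linarith
  then have "norm (x + y) powr p \<le> (2 * max (norm x) (norm y)) powr p"
    using assms by (intro powr_mono2) auto
  also have "\<dots> = 2 powr p * max (norm x) (norm y) powr p"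
    by (simp add: powr_mult)
  also have "\<dots> \<le> 2 powr p * (norm x powr p + norm y powr p)"
    by (intro mult_left_mono) (auto simp: max_def)
  finally show ?thesis .
qed

lemma Lp_diff:
  fixes f g :: "'a::euclidean_space \<Rightarrow> 'b::euclidean_space"
  assumes "f \<in> Lp p \<Omega>" "g \<in> Lp p \<Omega>" "0 \<le> p"
  shows "(\<lambda>x. f x - g x) \<in> Lp p \<Omega>"
proof -
  have [measurable]: "f \<in> borel_measurable (lebesgue_on \<Omega>)" "g \<in> borel_measurable (lebesgue_on \<Omega>)"
    using assms by (auto simp: Lp_def)
  have "integrable (lebesgue_on \<Omega>) (\<lambda>x. norm (f x - g x) powr p)"
  proof (rule Bochner_Integration.integrable_bound)
    show "integrable (lebesgue_on \<Omega>) (\<lambda>x. 2 powr p * (norm (f x) powr p + norm (g x) powr p))"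
      using assms by (auto simp: Lp_def)
    show "AE x in lebesgue_on \<Omega>. norm (norm (f x - g x) powr p) \<le> norm (2 powr p * (norm (f x) powr p + norm (g x) powr p))"
      using norm_add_powr_le[OF assms(3), of "f _" "- g _"] by simp
  qed measurable
  then show ?thesis by (simp add: Lp_def)
qed

lemma Lp_bounded:
  fixes f :: "'a::euclidean_space \<Rightarrow> 'b::euclidean_space"
  assumes "\<Omega> \<in> lmeasurable" "f \<in> borel_measurable (lebesgue_on \<Omega>)" "\<And>x. norm (f x) \<le> B" "0 \<le> p"
  shows "f \<in> Lp p \<Omega>"
proof -
  interpret finite_measure "lebesgue_on \<Omega>" using assms(1) by (rule finite_measure_lebesgue_on)
  note [measurable] = assms(2)
  have "integrable (lebesgue_on \<Omega>) (\<lambda>x. norm (f x) powr p)"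
    using assms(3,4) by (intro integrable_const_bound[where B = "B powr p"]) (auto intro!: powr_mono2)
  then show ?thesis using assms(2) by (simp add: Lp_def)
qed

lemma abs_le_one_plus_powr: "1 \<le> p \<Longrightarrow> \<bar>t\<bar> \<le> 1 + \<bar>t\<bar> powr p" for t :: real
  using powr_mono[of 1 p "\<bar>t\<bar>"] powr_ge_zero[of "\<bar>t\<bar>" p] by (cases "1 \<le> \<bar>t\<bar>") (simp, linarith)

lemma integrable_Lp:
  fixes f :: "'a::euclidean_space \<Rightarrow> real"
  assumes "f \<in> Lp p \<Omega>" "1 \<le> p" "\<Omega> \<in> lmeasurable"
  shows "integrable (lebesgue_on \<Omega>) f"
proof -
  interpret finite_measure "lebesgue_on \<Omega>" using assms(3) by (rule finite_measure_lebesgue_on)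
  show ?thesis
  proof (rule Bochner_Integration.integrable_bound)
    show "integrable (lebesgue_on \<Omega>) (\<lambda>x. 1 + \<bar>f x\<bar> powr p)" "f \<in> borel_measurable (lebesgue_on \<Omega>)"
      using assms by (auto simp: Lp_def)
    show "AE x in lebesgue_on \<Omega>. norm (f x) \<le> norm (1 + \<bar>f x\<bar> powr p)"
      using abs_le_one_plus_powr[OF assms(2)] by simp
  qed
qed

lemma integrable_mult_bounded:
  fixes h k :: "'a \<Rightarrow> real"
  assumes "integrable M h" "k \<in> borel_measurable M" "\<And>x. \<bar>k x\<bar> \<le> C"
  shows "integrable M (\<lambda>x. h x * k x)"
proof (rule Bochner_Integration.integrable_bound)
  show "integrable M (\<lambda>x. C * \<bar>h x\<bar>)" using assms(1) by simp
  show "AE x in M. norm (h x * k x) \<le> norm (C * \<bar>h x\<bar>)"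
  proof (rule AE_I2)
    fix x
    have "\<bar>h x\<bar> * \<bar>k x\<bar> \<le> \<bar>h x\<bar> * C" by (intro mult_left_mono assms(3)) auto
    also have "\<dots> \<le> \<bar>C * \<bar>h x\<bar>\<bar>" by (metis abs_ge_self mult.commute)
    finally show "norm (h x * k x) \<le> norm (C * \<bar>h x\<bar>)" by (simp add: abs_mult)
  qed
qed (use assms in auto)

lemma Lp_norm_tendsto_0D:
  assumes "0 < p" "(\<lambda>n. Lp_norm p \<Omega> (h n)) \<longlonglongrightarrow> 0"
  shows "(\<lambda>n. \<integral>x. norm (h n x) powr p \<partial>lebesgue_on \<Omega>) \<longlonglongrightarrow> 0"
proof -
  have "(\<lambda>n. Lp_norm p \<Omega> (h n) powr p) \<longlonglongrightarrow> 0"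
    by (rule tendsto_zero_powrI[OF assms(2) tendsto_const]) (use assms(1) in \<open>auto simp: Lp_norm_def\<close>)
  moreover have "Lp_norm p \<Omega> (h n) powr p = (\<integral>x. norm (h n x) powr p \<partial>lebesgue_on \<Omega>)" for n
    using assms(1) integral_nonneg_AE[of "\<lambda>x. norm (h n x) powr p" "lebesgue_on \<Omega>"]
    by (simp add: Lp_norm_def powr_powr)
  ultimately show ?thesis by simp
qed

lemma bounded_range_of_bounded_support:
  fixes f :: "'a::euclidean_space \<Rightarrow> 'b::real_normed_vector"
  assumes c: "continuous_on UNIV f" and b: "bounded {x. f x \<noteq> 0}"
  obtains B where "\<And>x. norm (f x) \<le> B"
proof -
  let ?K = "closure {x. f x \<noteq> 0}"
  have "compact (f ` ?K)"
    using b by (intro compact_continuous_image continuous_on_subset[OF c]) auto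
  then have "bounded (f ` ?K)" by (rule compact_imp_bounded)
  then have "\<exists>B. \<forall>y\<in>f ` ?K. norm y \<le> B" by (simp only: bounded_iff)
  then obtain B where B: "\<forall>y\<in>f ` ?K. norm y \<le> B" by blast
  have "norm (f x) \<le> max B 0" for x
  proof (cases "f x = 0")
    case False
    then have "f x \<in> f ` ?K" using closure_subset[of "{x. f x \<noteq> 0}"] by blast
    then show ?thesis using B by (auto simp: le_max_iff_disj)
  qed auto
  then show ?thesis by (rule that)
qed

lemma integral_lebesgue_on_eq_lborel:
  fixes h :: "'a::euclidean_space \<Rightarrow> real"
  assumes "h \<in> borel_measurable borel" "\<Omega> \<in> sets lebesgue" "\<And>x. x \<notin> \<Omega> \<Longrightarrow> h x = 0"
  shows "(\<integral>x. h x \<partial>lebesgue_on \<Omega>) = (\<integral>x. h x \<partial>lborel)"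
proof -
  have "(\<integral>x. h x \<partial>lebesgue_on \<Omega>) = (\<integral>x. indicator \<Omega> x *\<^sub>R h x \<partial>lebesgue)"
    using assms(2) by (intro integral_restrict_space) auto
  also have "(\<lambda>x. indicator \<Omega> x *\<^sub>R h x) = h"
    using assms(3) by (auto simp: fun_eq_iff indicator_def)
  also have "integral\<^sup>L lebesgue h = integral\<^sup>L lborel h"
    using assms(1) by (intro integral_completion) auto
  finally show ?thesis .
qed

text \<open>A non-integrable \<open>h\<close> has integral 0 by convention, and the bound is
  nonnegative. So the flux integral can be estimated from a pointwise bound alone.\<close>

lemma abs_integral_le_of_AE_bound:
  fixes h B :: "'a \<Rightarrow> real"
  assumes B: "integrable M B" and le: "AE x in M. \<bar>h x\<bar> \<le> B x"
  shows "\<bar>\<integral>x. h x \<partial>M\<bar> \<le> (\<integral>x. B x \<partial>M)"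
proof (cases "integrable M h")
  case True
  have "\<bar>\<integral>x. h x \<partial>M\<bar> \<le> (\<integral>x. \<bar>h x\<bar> \<partial>M)" by (rule integral_abs_bound)
  also have "\<dots> \<le> (\<integral>x. B x \<partial>M)" using True B le by (intro integral_mono_AE) auto
  finally show ?thesis .
next
  case False
  have "0 \<le> (\<integral>x. B x \<partial>M)" using le by (intro integral_nonneg_AE) auto
  with False show ?thesis by (simp add: not_integrable_integral_eq)
qed

lemma test_functionsD:
  assumes "\<phi> \<in> test_functions \<Omega>"
  shows "C_k k \<phi>" "continuous_on UNIV \<phi>" "continuous_on UNIV (grad \<phi>)"
    "bounded {x. \<phi> x \<noteq> 0}" "x \<notin> \<Omega> \<Longrightarrow> \<phi> x = 0" "bounded {x. grad \<phi> x \<noteq> 0}"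
proof -
  let ?K = "closure {x. \<phi> x \<noteq> 0}"
  show C: "C_k k \<phi>" for k using assms by (simp add: test_functions_def)
  show "continuous_on UNIV \<phi>" using C[of 0] by simp
  show "continuous_on UNIV (grad \<phi>)" using C by (rule continuous_on_grad)
  have K: "bounded ?K" "?K \<subseteq> \<Omega>"
    using assms by (auto simp: test_functions_def compact_imp_bounded)
  show "bounded {x. \<phi> x \<noteq> 0}" using K(1) closure_subset by (rule bounded_subset)
  show "x \<notin> \<Omega> \<Longrightarrow> \<phi> x = 0" using K(2) closure_subset[of "{x. \<phi> x \<noteq> 0}"] by auto
  have "grad \<phi> x = 0" if "x \<notin> ?K" for x
  proof (rule grad_eqI)
    have "((\<lambda>x. 0) has_derivative (\<lambda>h. 0)) (at x)" by simp
    then have "(\<phi> has_derivative (\<lambda>h. 0)) (at x)"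
      by (rule has_derivative_transform_within_open[of _ _ _ _ "- ?K"])
        (use that closure_subset[of "{x. \<phi> x \<noteq> 0}"] in auto)
    moreover have "(\<bullet>) (0::'a) = (\<lambda>h. 0)" by (auto simp: fun_eq_iff)
    ultimately show "(\<phi> has_derivative (\<bullet>) 0) (at x)" by simp
  qed
  then show "bounded {x. grad \<phi> x \<noteq> 0}" by (intro bounded_subset[OF K(1)]) auto
qed

text \<open>The function |t| psi(t)^(1/p) of \<open>Psi_eq\<close>, to which Sobolev's inequality is
  applied, written as another \<open>wt\<close> so that the lemmas on that family cover it. As 1 +
  2m/p > 1 it is continuously differentiable, which is all that \<open>Sobolev\<close> asks
  for.\<close>

definition Psi :: "real \<Rightarrow> real \<Rightarrow> real \<Rightarrow> real \<Rightarrow> real \<Rightarrow> real" where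
  "Psi p m \<gamma> e t = wt (1 + 2 * m / p) ((m - \<gamma> / 2) / p) (\<gamma> / 2 / p) e t"

definition Psi' :: "real \<Rightarrow> real \<Rightarrow> real \<Rightarrow> real \<Rightarrow> real \<Rightarrow> real" where
  "Psi' p m \<gamma> e t = wt' (1 + 2 * m / p) ((m - \<gamma> / 2) / p) (\<gamma> / 2 / p) e t"

lemma Psi_eq: "Psi p m \<gamma> e t = \<bar>t\<bar> * psi m \<gamma> e t powr (1 / p)"
proof -
  have "\<bar>t\<bar> powr (1 + 2 * m / p) = \<bar>t\<bar> * (\<bar>t\<bar> powr (2 * m)) powr (1 / p)"
    using powr_mult_base'[of t "2 * m / p"] by (simp add: powr_powr) (metis powr_mult_base abs_ge_zero)
  moreover have "(\<gamma> / 2 - m) / p = - ((m - \<gamma> / 2) / p)"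
    by (simp add: minus_divide_left)
  ultimately show ?thesis
    unfolding Psi_def psi_def wt_def by (simp add: powr_mult powr_powr)
qed

lemma Psi_powr:
  assumes "1 < p" "p < n"
  shows "\<bar>Psi p m \<gamma> e t\<bar> powr (n * p / (n - p)) = (\<bar>t\<bar> powr p * psi m \<gamma> e t) powr (n / (n - p))"
proof -
  have "\<bar>Psi p m \<gamma> e t\<bar> powr p = \<bar>t\<bar> powr p * psi m \<gamma> e t"
    using assms psi_nonneg[of m \<gamma> e t] by (simp add: Psi_eq abs_mult powr_mult powr_powr)
  moreover have "\<bar>Psi p m \<gamma> e t\<bar> powr (n * p / (n - p)) = (\<bar>Psi p m \<gamma> e t\<bar> powr p) powr (n / (n - p))"
    by (simp add: powr_powr mult.commute)
  ultimately show ?thesis by simp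
qed

text \<open>By \<open>abs_wt'_le\<close>, |t Psi'| is at most a multiple of Psi = |t| psi^(1/p);
  cancel |t|. Hence |Psi'(\<phi>) grad \<phi>|^p is controlled by psi(\<phi>) |grad
  \<phi>|^p.\<close>

lemma abs_Psi'_powr_le:
  assumes p: "1 < p" and m: "0 \<le> \<gamma>" "\<gamma> \<le> 2 * m" "0 \<le> e"
  shows "\<bar>Psi' p m \<gamma> e t\<bar> powr p \<le> (1 + 4 * m / p) powr p * psi m \<gamma> e t"
proof (cases "t = 0")
  case True
  then show ?thesis using p by (simp add: Psi'_def wt'_def psi_nonneg)
next
  case False
  have K: "(1 + 2 * m / p) + 2 * ((m - \<gamma> / 2) / p) + 2 * (\<gamma> / 2 / p) = 1 + 4 * m / p"
    using p by (simp add: field_simps)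
  have "\<bar>t\<bar> * \<bar>Psi' p m \<gamma> e t\<bar> \<le> (1 + 4 * m / p) * Psi p m \<gamma> e t"
    unfolding Psi_def Psi'_def K[symmetric] using p m by (intro abs_wt'_le) auto
  then have "\<bar>Psi' p m \<gamma> e t\<bar> \<le> (1 + 4 * m / p) * psi m \<gamma> e t powr (1 / p)"
    using False unfolding Psi_eq by (simp add: mult.left_commute)
  then have "\<bar>Psi' p m \<gamma> e t\<bar> powr p \<le> ((1 + 4 * m / p) * psi m \<gamma> e t powr (1 / p)) powr p"
    using p by (intro powr_mono2) auto
  also have "\<dots> = (1 + 4 * m / p) powr p * psi m \<gamma> e t"
    using p psi_nonneg[of m \<gamma> e t] by (simp add: powr_mult powr_powr)
  finally show ?thesis .
qed

section \<open>The energy estimates\<close>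

text \<open>In the zero order terms and in the term |\<nabla>u|^p of the tested inequality,
  \<open>\<phi> k\<close> occurs only inside a bounded continuous function, so dominated convergence
  suffices. Its gradient occurs in the flux and in Sobolev's inequality; replacing it there by
  \<open>g\<close> costs an error that vanishes in the limit. The second estimate is stated with the
  nonnegative integral in order to include finiteness.\<close>

lemma energy_estimates:
  fixes \<Omega> :: "'a::euclidean_space set" and u f :: "'a \<Rightarrow> real" and g :: "'a \<Rightarrow> 'a"
    and a :: "'a \<Rightarrow> real \<Rightarrow> 'a \<Rightarrow> 'a" and \<phi> :: "nat \<Rightarrow> 'a \<Rightarrow> real" and m :: nat
  defines "M \<equiv> lebesgue_on \<Omega>" and "n \<equiv> real DIM('a)"
  assumes \<Omega>: "open \<Omega>" "bounded \<Omega>"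
    and p: "2 < p" "p < n"
    and \<beta>: "0 < \<beta>" and growth: "AE x in M. \<forall>s \<xi>. norm (a x s \<xi>) \<le> \<beta> * (1 + norm \<xi>)"
    and f: "integrable M f" and u: "u \<in> Lp p \<Omega>"
    and g: "g = weak_grad \<Omega> u" "g \<in> Lp p \<Omega>"
    and \<phi>: "\<And>k. \<phi> k \<in> test_functions \<Omega>" "AE x in M. (\<lambda>k. \<phi> k x) \<longlonglongrightarrow> u x"
      "(\<lambda>k. \<integral>x. norm (g x - grad (\<phi> k) x) powr p \<partial>M) \<longlonglongrightarrow> 0"
    and sub: "distributional_subsolution \<Omega> a lam p f u"
    and m: "0 < m" "0 \<le> \<gamma>" "\<gamma> \<le> 2 * real m" and e: "0 < e" "e \<le> 1"
  defines "P \<equiv> psi (real m) \<gamma> e" and "P' \<equiv> psi' (real m) \<gamma> e"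
  defines "I \<equiv> (\<integral>x. norm (g x) powr p * P (u x) \<partial>M)"
    and "S \<equiv> (p * (n - 1) / (n - p)) powr p * ((1 + 4 * real m / p) powr p * 2 powr p)"
  shows "I \<le> (\<integral>x. \<bar>f x\<bar> * P (u x) \<partial>M) + \<bar>lam\<bar> * (\<integral>x. \<bar>u x\<bar> * P (u x) \<partial>M)
      + (\<integral>x. \<beta> * (1 + norm (g x)) * norm (g x) * \<bar>P' (u x)\<bar> \<partial>M)"
    and "(\<integral>\<^sup>+x. ennreal ((\<bar>u x\<bar> powr p * P (u x)) powr (n / (n - p))) \<partial>M) \<le> ennreal ((S * I) powr (n / (n - p)))"
proof -
  have \<Omega>m: "\<Omega> \<in> lmeasurable" "\<Omega> \<in> sets lebesgue" using \<Omega> by (auto intro: lmeasurable_open)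
  interpret finite_measure M unfolding M_def by (rule finite_measure_lebesgue_on[OF \<Omega>m(1)])
  have Mb: "h \<in> borel_measurable M" if "h \<in> borel_measurable borel" for h :: "'a \<Rightarrow> 'b::euclidean_space"
    unfolding M_def using that by (intro measurable_restrict_space1 measurable_completion) auto
  have [measurable]: "u \<in> borel_measurable M" "g \<in> borel_measurable M" "f \<in> borel_measurable M"
    using u g f unfolding M_def by (auto simp: Lp_def)
  note T = test_functionsD[OF \<phi>(1)]
  have \<phi>b[measurable]: "\<phi> k \<in> borel_measurable borel" "grad (\<phi> k) \<in> borel_measurable borel" for k
    using T(2,3) by (auto intro: borel_measurable_continuous_onI)
  have [measurable]: "\<phi> k \<in> borel_measurable M" "grad (\<phi> k) \<in> borel_measurable M" for k
    using \<phi>b by (auto intro: Mb)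
  have cP: "continuous_on UNIV P" and cP': "continuous_on UNIV P'"
    unfolding P_def P'_def psi_def[abs_def] psi'_def[abs_def]
    using m e by (auto intro!: continuous_wt continuous_wt')
  then have Pm[measurable]: "P \<in> borel_measurable borel" "P' \<in> borel_measurable borel"
    by (auto intro: borel_measurable_continuous_onI)
  have iP: "isCont P t" "isCont P' t" for t
    using cP cP' by (auto simp: continuous_on_eq_continuous_at)
  define B where "B = e powr (- (\<gamma> / 2))"
  have P0: "0 \<le> P t" for t by (simp add: P_def psi_nonneg)
  have PB: "P t \<le> B" for t unfolding P_def B_def using m e by (intro psi_bounded) auto
  have B0: "0 \<le> B" by (simp add: B_def)
  obtain B' where B': "\<And>t. \<bar>P' t\<bar> \<le> B'"
    unfolding P'_def using psi'_bounded[of \<gamma> "real m" e] m e by auto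
  have B'0: "0 \<le> B'" using B'[of 0] by linarith
  have P00: "P 0 = 0" by (simp add: P_def psi_def)
  have gL: "integrable M (\<lambda>x. norm (g x) powr p)" using g by (simp add: Lp_def M_def)
  have uL: "integrable M (\<lambda>x. \<bar>u x\<bar> powr p)" using u by (simp add: Lp_def M_def)
  have gradLp: "grad (\<phi> k) \<in> Lp p \<Omega>" for k
  proof -
    obtain C where "\<And>x. norm (grad (\<phi> k) x) \<le> C"
      using bounded_range_of_bounded_support[OF T(3,6)] by blast
    then show ?thesis
      using p Mb[OF \<phi>b(2)] by (intro Lp_bounded[OF \<Omega>m(1)]) (auto simp: M_def)
  qed
  define D where "D k x = norm (g x - grad (\<phi> k) x)" for k x
  have D0: "0 \<le> D k x" for k x by (simp add: D_def)
  have [measurable]: "D k \<in> borel_measurable M" for k unfolding D_def by measurable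
  have DL: "integrable M (\<lambda>x. D k x powr p)" for k
    using Lp_diff[OF g(2) gradLp, of k] p by (simp add: Lp_def M_def D_def)
  define \<epsilon> where "\<epsilon> k = (\<integral>x. D k x powr p \<partial>M)" for k
  have \<epsilon>: "\<epsilon> \<longlonglongrightarrow> 0" using \<phi>(3) by (simp add: \<epsilon>_def[abs_def] D_def)
  have g1L: "integrable M (\<lambda>x. (1 + norm (g x)) powr p)"
  proof (rule Bochner_Integration.integrable_bound)
    show "integrable M (\<lambda>x. 2 powr p * (1 + norm (g x) powr p))" using gL by simp
    show "AE x in M. norm ((1 + norm (g x)) powr p) \<le> norm (2 powr p * (1 + norm (g x) powr p))"
      using norm_add_powr_le[of p 1 "norm (g _)"] p by simp
  qed measurable
  have g1pow: "integrable M (\<lambda>x. (1 + norm (g x)) powr r)" if "r \<le> p" for r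
    by (rule Bochner_Integration.integrable_bound[OF g1L]) (use that in \<open>auto intro!: powr_mono AE_I2\<close>)
  have gg: "integrable M (\<lambda>x. (1 + norm (g x)) * norm (g x))"
  proof (rule Bochner_Integration.integrable_bound[OF g1pow[of 2]])
    show "AE x in M. norm ((1 + norm (g x)) * norm (g x)) \<le> norm ((1 + norm (g x)) powr 2)"
      by (auto simp: power2_eq_square intro!: AE_I2 mult_left_mono)
  qed (use p in auto)
  \<comment> \<open>The error in the flux, by Hoelder's inequality with exponents p/(p-1) and p; the
    first factor is finite because p/(p-1) \<le> p.\<close>
  have gD: "integrable M (\<lambda>x. (1 + norm (g x)) * D k x)"
    "(\<integral>x. (1 + norm (g x)) * D k x \<partial>M) \<le> (\<integral>x. (1 + norm (g x)) powr (p / (p - 1)) \<partial>M) powr (1 - 1 / p) * \<epsilon> k powr (1 / p)" for k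
  proof -
    have eq: "((1 + norm (g x)) powr (p / (p - 1))) powr (1 - 1 / p) * (D k x powr p) powr (1 / p) = (1 + norm (g x)) * D k x" for x
    proof -
      have "p / (p - 1) * (1 - 1 / p) = 1" using p by (simp add: field_simps)
      then have "((1 + norm (g x)) powr (p / (p - 1))) powr (1 - 1 / p) = 1 + norm (g x)"
        by (simp only: powr_powr) simp
      moreover have "(D k x powr p) powr (1 / p) = D k x"
        using p D0 by (simp add: powr_powr)
      ultimately show ?thesis by simp
    qed
    have pp: "p / (p - 1) \<le> p" using p by (simp add: field_simps)
    note H = integral_Holder[of "1 - 1 / p" "1 / p" M "\<lambda>x. (1 + norm (g x)) powr (p / (p - 1))" "\<lambda>x. D k x powr p"]
    show "integrable M (\<lambda>x. (1 + norm (g x)) * D k x)"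
      using H(1) p g1pow[OF pp] DL by (simp add: eq)
    show "(\<integral>x. (1 + norm (g x)) * D k x \<partial>M) \<le> (\<integral>x. (1 + norm (g x)) powr (p / (p - 1)) \<partial>M) powr (1 - 1 / p) * \<epsilon> k powr (1 / p)"
      using H(2) p g1pow[OF pp] DL by (simp add: eq \<epsilon>_def)
  qed
  have gD0: "(\<lambda>k. \<integral>x. (1 + norm (g x)) * D k x \<partial>M) \<longlonglongrightarrow> 0"
  proof (rule tendsto_sandwich)
    show "\<forall>\<^sub>F k in sequentially. 0 \<le> (\<integral>x. (1 + norm (g x)) * D k x \<partial>M)"
      using D0 by (intro always_eventually allI integral_nonneg_AE AE_I2 mult_nonneg_nonneg) auto
    show "\<forall>\<^sub>F k in sequentially. (\<integral>x. (1 + norm (g x)) * D k x \<partial>M) \<le> (\<integral>x. (1 + norm (g x)) powr (p / (p - 1)) \<partial>M) powr (1 - 1 / p) * \<epsilon> k powr (1 / p)"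
      using gD(2) by (intro always_eventually allI)
    have "(\<lambda>k. \<epsilon> k powr (1 / p)) \<longlonglongrightarrow> 0"
      by (rule tendsto_zero_powrI[OF \<epsilon> tendsto_const])
        (use p D0 in \<open>auto simp: \<epsilon>_def intro!: integral_nonneg_AE\<close>)
    then show "(\<lambda>k. (\<integral>x. (1 + norm (g x)) powr (p / (p - 1)) \<partial>M) powr (1 - 1 / p) * \<epsilon> k powr (1 / p)) \<longlonglongrightarrow> 0"
      by (rule tendsto_mult_right_zero)
  qed auto
  have lim: "(\<lambda>k. \<integral>x. h x * Q (\<phi> k x) \<partial>M) \<longlonglongrightarrow> (\<integral>x. h x * Q (u x) \<partial>M)"
    and int: "integrable M (\<lambda>x. h x * Q (\<phi> k x))"
    if h: "integrable M h" and Q: "continuous_on UNIV Q" "\<And>t. \<bar>Q t\<bar> \<le> C" for h :: "'a \<Rightarrow> real" and Q :: "real \<Rightarrow> real" and C k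
  proof -
    note [measurable] = borel_measurable_integrable[OF h] borel_measurable_continuous_onI[OF Q(1)]
    have C: "integrable M (\<lambda>x. C * \<bar>h x\<bar>)" using h by simp
    have bd: "norm (h x * Q t) \<le> C * \<bar>h x\<bar>" for x t
      using mult_left_mono[OF Q(2)[of t], of "\<bar>h x\<bar>"] by (simp add: abs_mult mult.commute)
    show "(\<lambda>k. \<integral>x. h x * Q (\<phi> k x) \<partial>M) \<longlonglongrightarrow> (\<integral>x. h x * Q (u x) \<partial>M)"
    proof (rule integral_dominated_convergence[OF _ _ C])
      show "AE x in M. (\<lambda>k. h x * Q (\<phi> k x)) \<longlonglongrightarrow> h x * Q (u x)"
        using \<phi>(2)
      proof eventually_elim
        case (elim x)
        have "isCont Q (u x)" using Q(1) by (auto simp: continuous_on_eq_continuous_at)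
        then show ?case by (intro tendsto_mult tendsto_const isCont_tendsto_compose[OF _ elim])
      qed
    qed (use bd in auto)
    show "integrable M (\<lambda>x. h x * Q (\<phi> k x))"
      by (rule Bochner_Integration.integrable_bound[OF C]) (use bd in \<open>auto intro!: AE_I2 intro: order_trans[OF _ abs_ge_self]\<close>)
  qed
  have aPB: "\<bar>P t\<bar> \<le> B" for t using P0 PB by simp
  have aP'B: "\<bar>\<bar>P' t\<bar>\<bar> \<le> B'" for t using B' by simp
  have caP': "continuous_on UNIV (\<lambda>t. \<bar>P' t\<bar>)" using cP' by (rule continuous_on_rabs)
  have absf: "integrable M (\<lambda>x. \<bar>f x\<bar>)" using f by simp
  have uint: "integrable M (\<lambda>x. \<bar>u x\<bar>)"
    using integrable_Lp[OF u _ \<Omega>m(1)] p by (simp add: M_def)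
  have bgg: "integrable M (\<lambda>x. \<beta> * (1 + norm (g x)) * norm (g x))"
    using gg by (simp add: mult.assoc)
  \<comment> \<open>The gradient of \<open>u\<close> with the weight at \<open>\<phi> k\<close>:
    this is what testing with \<open>P (\<phi> k)\<close> produces.\<close>
  define J where "J k = (\<integral>x. norm (g x) powr p * P (\<phi> k x) \<partial>M)" for k
  have Jlim: "J \<longlonglongrightarrow> I"
    unfolding J_def I_def by (rule lim[OF gL cP aPB])
  show "I \<le> (\<integral>x. \<bar>f x\<bar> * P (u x) \<partial>M) + \<bar>lam\<bar> * (\<integral>x. \<bar>u x\<bar> * P (u x) \<partial>M)
      + (\<integral>x. \<beta> * (1 + norm (g x)) * norm (g x) * \<bar>P' (u x)\<bar> \<partial>M)"
  proof (rule LIMSEQ_le[OF Jlim])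
    show "(\<lambda>k. (\<integral>x. \<bar>f x\<bar> * P (\<phi> k x) \<partial>M) + \<bar>lam\<bar> * (\<integral>x. \<bar>u x\<bar> * P (\<phi> k x) \<partial>M)
        + ((\<integral>x. \<beta> * (1 + norm (g x)) * norm (g x) * \<bar>P' (\<phi> k x)\<bar> \<partial>M)
           + \<beta> * B' * (\<integral>x. (1 + norm (g x)) * D k x \<partial>M)))
      \<longlonglongrightarrow> (\<integral>x. \<bar>f x\<bar> * P (u x) \<partial>M) + \<bar>lam\<bar> * (\<integral>x. \<bar>u x\<bar> * P (u x) \<partial>M)
      + (\<integral>x. \<beta> * (1 + norm (g x)) * norm (g x) * \<bar>P' (u x)\<bar> \<partial>M)"
    proof (intro tendsto_add tendsto_mult tendsto_const)
      show "(\<lambda>k. (\<integral>x. \<beta> * (1 + norm (g x)) * norm (g x) * \<bar>P' (\<phi> k x)\<bar> \<partial>M)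
           + \<beta> * B' * (\<integral>x. (1 + norm (g x)) * D k x \<partial>M)) \<longlonglongrightarrow> (\<integral>x. \<beta> * (1 + norm (g x)) * norm (g x) * \<bar>P' (u x)\<bar> \<partial>M)"
        using tendsto_add[OF lim[OF bgg caP' aP'B] tendsto_mult_right_zero[OF gD0, of "\<beta> * B'"]] by simp
    qed (intro lim[OF absf cP aPB] lim[OF uint cP aPB])+
    show "\<exists>N. \<forall>k\<ge>N. J k \<le> (\<integral>x. \<bar>f x\<bar> * P (\<phi> k x) \<partial>M) + \<bar>lam\<bar> * (\<integral>x. \<bar>u x\<bar> * P (\<phi> k x) \<partial>M)
        + ((\<integral>x. \<beta> * (1 + norm (g x)) * norm (g x) * \<bar>P' (\<phi> k x)\<bar> \<partial>M)
           + \<beta> * B' * (\<integral>x. (1 + norm (g x)) * D k x \<partial>M))"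
    proof (intro exI allI impI)
      fix k
      let ?v = "\<lambda>x. P (\<phi> k x)"
      have v: "?v \<in> test_functions \<Omega>"
        using wt_test_function[OF \<phi>(1) m(1), of e] e unfolding P_def psi_def by simp
      have gv: "grad ?v x = P' (\<phi> k x) *\<^sub>R grad (\<phi> k) x" for x
        unfolding P_def P'_def psi_def psi'_def using m e T(1)
        by (intro grad_eqI wt_has_derivative) auto
      have main: "(\<integral>x. a x (u x) (g x) \<bullet> grad ?v x \<partial>M) + lam * (\<integral>x. u x * ?v x \<partial>M) + J k \<le> (\<integral>x. f x * ?v x \<partial>M)"
        using bspec[OF sub[unfolded distributional_subsolution_def] v, folded g(1) M_def] P0
        unfolding J_def by simp
      have f1: "(\<integral>x. f x * ?v x \<partial>M) \<le> (\<integral>x. \<bar>f x\<bar> * ?v x \<partial>M)"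
        by (intro integral_mono int[OF f cP aPB] int[OF absf cP aPB] mult_right_mono P0) auto
      have u1: "- (lam * (\<integral>x. u x * ?v x \<partial>M)) \<le> \<bar>lam\<bar> * (\<integral>x. \<bar>u x\<bar> * ?v x \<partial>M)"
      proof -
        have "\<bar>\<integral>x. u x * ?v x \<partial>M\<bar> \<le> (\<integral>x. \<bar>u x\<bar> * ?v x \<partial>M)"
          by (intro abs_integral_le_of_AE_bound int[OF uint cP aPB]) (auto simp: abs_mult P0)
        then have "\<bar>lam\<bar> * \<bar>\<integral>x. u x * ?v x \<partial>M\<bar> \<le> \<bar>lam\<bar> * (\<integral>x. \<bar>u x\<bar> * ?v x \<partial>M)"
          by (rule mult_left_mono) auto
        moreover have "- (lam * X) \<le> \<bar>lam\<bar> * \<bar>X\<bar>" for X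
          using abs_ge_minus_self[of "lam * X"] by (simp add: abs_mult)
        ultimately show ?thesis by (rule order_trans[rotated])
      qed
      have ib: "integrable M (\<lambda>x. \<beta> * (1 + norm (g x)) * norm (g x) * \<bar>P' (\<phi> k x)\<bar> + \<beta> * B' * ((1 + norm (g x)) * D k x))"
        using int[OF bgg caP' aP'B] gD(1) by simp
      have "\<bar>\<integral>x. a x (u x) (g x) \<bullet> grad ?v x \<partial>M\<bar> \<le>
          (\<integral>x. \<beta> * (1 + norm (g x)) * norm (g x) * \<bar>P' (\<phi> k x)\<bar> + \<beta> * B' * ((1 + norm (g x)) * D k x) \<partial>M)"
      proof (rule abs_integral_le_of_AE_bound[OF ib])
        show "AE x in M. \<bar>a x (u x) (g x) \<bullet> grad ?v x\<bar> \<le> \<beta> * (1 + norm (g x)) * norm (g x) * \<bar>P' (\<phi> k x)\<bar> + \<beta> * B' * ((1 + norm (g x)) * D k x)"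
          using growth
        proof eventually_elim
          case (elim x)
          have gr: "norm (grad (\<phi> k) x) \<le> norm (g x) + D k x"
            unfolding D_def by (metis norm_minus_commute norm_triangle_sub)
          have "\<bar>a x (u x) (g x) \<bullet> grad ?v x\<bar> \<le> norm (a x (u x) (g x)) * norm (grad ?v x)"
            by (rule Cauchy_Schwarz_ineq2)
          also have "\<dots> \<le> (\<beta> * (1 + norm (g x))) * (\<bar>P' (\<phi> k x)\<bar> * (norm (g x) + D k x))"
            unfolding gv norm_scaleR using elim gr \<beta> by (intro mult_mono) auto
          also have "\<dots> = \<beta> * (1 + norm (g x)) * norm (g x) * \<bar>P' (\<phi> k x)\<bar> + (\<beta> * ((1 + norm (g x)) * D k x)) * \<bar>P' (\<phi> k x)\<bar>"
            by (simp add: algebra_simps)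
          \<comment> \<open>Next to \<open>norm (g x)\<close> the factor |P'| must survive, because
            its limit is what \<open>flux_bound\<close> handles; next to the vanishing error
            \<open>D k\<close> the crude bound \<open>B'\<close> is enough.\<close>
          also have "\<dots> \<le> \<beta> * (1 + norm (g x)) * norm (g x) * \<bar>P' (\<phi> k x)\<bar> + (\<beta> * ((1 + norm (g x)) * D k x)) * B'"
            using B' \<beta> D0 by (intro add_left_mono mult_left_mono) auto
          finally show ?case by (simp add: mult_ac)
        qed
      qed
      also have "\<dots> = (\<integral>x. \<beta> * (1 + norm (g x)) * norm (g x) * \<bar>P' (\<phi> k x)\<bar> \<partial>M)
           + \<beta> * B' * (\<integral>x. (1 + norm (g x)) * D k x \<partial>M)"
        using int[OF bgg caP' aP'B] gD(1) by simp
      finally show "J k \<le> (\<integral>x. \<bar>f x\<bar> * P (\<phi> k x) \<partial>M) + \<bar>lam\<bar> * (\<integral>x. \<bar>u x\<bar> * P (\<phi> k x) \<partial>M)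
        + ((\<integral>x. \<beta> * (1 + norm (g x)) * norm (g x) * \<bar>P' (\<phi> k x)\<bar> \<partial>M)
           + \<beta> * B' * (\<integral>x. (1 + norm (g x)) * D k x \<partial>M))"
        using main f1 u1 by linarith
    qed
  qed
  define Q where "Q = Psi p (real m) \<gamma> e"
  define Q' where "Q' = Psi' p (real m) \<gamma> e"
  have \<alpha>: "1 < 1 + 2 * real m / p" using m p by simp
  have cQ: "continuous_on UNIV Q" and cQ': "continuous_on UNIV Q'"
    unfolding Q_def Q'_def Psi_def[abs_def] Psi'_def[abs_def]
    using \<alpha> e by (auto intro!: continuous_wt continuous_wt')
  have [measurable]: "Q \<in> borel_measurable borel" "Q' \<in> borel_measurable borel"
    using cQ cQ' by (auto intro: borel_measurable_continuous_onI)
  have Q0: "Q 0 = 0" by (simp add: Q_def Psi_def)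
  define ps where "ps = n * p / (n - p)"
  have ps: "0 < ps" using p by (simp add: ps_def)
  define \<kappa> where "\<kappa> = n / (n - p)"
  have \<kappa>: "0 < \<kappa>" "(n - p) / n * \<kappa> = 1" using p by (auto simp: \<kappa>_def)
  define K where "K = (1 + 4 * real m / p) powr p"
  have K0: "0 \<le> K" by (simp add: K_def)
  have Qe: "\<bar>Q t\<bar> powr ps = (\<bar>t\<bar> powr p * P t) powr \<kappa>" for t
    unfolding Q_def P_def ps_def \<kappa>_def using p by (intro Psi_powr) auto
  have step: "(\<integral>\<^sup>+x. ennreal (\<bar>Q (\<phi> k x)\<bar> powr ps) \<partial>M) \<le> ennreal ((S * (J k + B * \<epsilon> k)) powr \<kappa>)" for k
  proof -
    let ?v = "\<lambda>x. Q (\<phi> k x)" and ?g = "\<lambda>x. Q' (\<phi> k x) *\<^sub>R grad (\<phi> k) x"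
    have d: "(?v has_derivative (\<lambda>h. ?g x \<bullet> h)) (at x)" for x
      unfolding Q_def Q'_def Psi_def Psi'_def using \<alpha> e T(1) by (intro wt_has_derivative) auto
    have cg: "continuous_on UNIV ?g"
      by (intro continuous_on_scaleR T(3) continuous_on_compose2[OF cQ' T(2)]) auto
    have cv: "continuous_on UNIV ?v"
      by (intro continuous_on_compose2[OF cQ T(2)]) auto
    have bv: "bounded {x. ?v x \<noteq> 0}"
      by (rule bounded_subset[OF T(4)[of k]]) (auto simp: Q0)
    have sob: "(\<integral>x. \<bar>?v x\<bar> powr ps \<partial>lborel) powr ((n - p) / n)
      \<le> (p * (n - 1) / (n - p)) powr p * (\<integral>x. norm (?g x) powr p \<partial>lborel)"
      unfolding n_def ps_def using p by (intro Sobolev[OF _ _ d cg bv]) (auto simp: n_def)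
    have Lv: "(\<integral>x. \<bar>?v x\<bar> powr ps \<partial>M) = (\<integral>x. \<bar>?v x\<bar> powr ps \<partial>lborel)"
      unfolding M_def using \<Omega>m T(5) Q0 by (intro integral_lebesgue_on_eq_lborel) auto
    have gle: "norm (?g x) powr p \<le> K * (P (\<phi> k x) * norm (grad (\<phi> k) x) powr p)" for x
    proof -
      have "\<bar>Q' (\<phi> k x)\<bar> powr p \<le> K * P (\<phi> k x)"
        unfolding Q'_def K_def P_def using p m e by (intro abs_Psi'_powr_le) auto
      from mult_right_mono[OF this, of "norm (grad (\<phi> k) x) powr p"] show ?thesis
        by (simp add: powr_mult mult_ac)
    qed
    have Lg: "(\<integral>x. norm (?g x) powr p \<partial>M) = (\<integral>x. norm (?g x) powr p \<partial>lborel)"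
    proof -
      have "norm (?g x) powr p = 0" if "x \<notin> \<Omega>" for x
        using gle[of x] T(5)[OF that, of k] P00 powr_ge_zero[of "norm (?g x)" p] by simp
      then show ?thesis
        unfolding M_def using \<Omega>m by (intro integral_lebesgue_on_eq_lborel) auto
    qed
    \<comment> \<open>Source of the factor 2^p in \<open>S\<close>: grad (\<phi> k) is compared with
      \<open>g\<close>. The weight stays with |g|^p to form \<open>J k\<close> and is replaced by
      its bound \<open>B\<close> in front of the error.\<close>
    have "norm (?g x) powr p \<le> K * (2 powr p * (norm (g x) powr p * P (\<phi> k x) + B * D k x powr p))" for x
    proof -
      have "norm (grad (\<phi> k) x) powr p \<le> 2 powr p * (norm (g x) powr p + D k x powr p)"
        using norm_add_powr_le[of p "g x" "grad (\<phi> k) x - g x"] p by (simp add: D_def norm_minus_commute)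
      then have "P (\<phi> k x) * norm (grad (\<phi> k) x) powr p \<le> P (\<phi> k x) * (2 powr p * (norm (g x) powr p + D k x powr p))"
        using P0 by (rule mult_left_mono)
      also have "\<dots> = 2 powr p * (norm (g x) powr p * P (\<phi> k x) + P (\<phi> k x) * D k x powr p)"
        by (simp add: algebra_simps)
      also have "\<dots> \<le> 2 powr p * (norm (g x) powr p * P (\<phi> k x) + B * D k x powr p)"
        by (intro mult_left_mono add_left_mono mult_right_mono PB) auto
      finally show ?thesis using gle[of x] K0 by (meson mult_left_mono order_trans)
    qed
    then have "(\<integral>x. norm (?g x) powr p \<partial>M) \<le> (\<integral>x. K * (2 powr p * (norm (g x) powr p * P (\<phi> k x) + B * D k x powr p)) \<partial>M)"
      using abs_integral_le_of_AE_bound[of M "\<lambda>x. K * (2 powr p * (norm (g x) powr p * P (\<phi> k x) + B * D k x powr p))" "\<lambda>x. norm (?g x) powr p"]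
        int[OF gL cP aPB] DL by auto
    also have "\<dots> = K * (2 powr p * (J k + B * \<epsilon> k))"
      using int[OF gL cP aPB] DL by (simp add: J_def \<epsilon>_def)
    finally have gb: "(\<integral>x. norm (?g x) powr p \<partial>M) \<le> K * (2 powr p * (J k + B * \<epsilon> k))" .
    define A where "A = (\<integral>x. \<bar>?v x\<bar> powr ps \<partial>M)"
    have A0: "0 \<le> A" by (simp add: A_def)
    have "A powr ((n - p) / n) \<le> (p * (n - 1) / (n - p)) powr p * (K * (2 powr p * (J k + B * \<epsilon> k)))"
      using sob mult_left_mono[OF gb, of "(p * (n - 1) / (n - p)) powr p"] unfolding A_def Lv Lg by simp
    also have "\<dots> = S * (J k + B * \<epsilon> k)" by (simp add: S_def K_def mult_ac)
    finally have "(A powr ((n - p) / n)) powr \<kappa> \<le> (S * (J k + B * \<epsilon> k)) powr \<kappa>"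
      using \<kappa> by (intro powr_mono2) auto
    then have Ale: "A \<le> (S * (J k + B * \<epsilon> k)) powr \<kappa>"
      using A0 by (simp only: powr_powr \<kappa>) simp
    obtain C where C: "\<And>x. norm (?v x) \<le> C"
      using bounded_range_of_bounded_support[OF cv bv] by blast
    have "integrable M (\<lambda>x. \<bar>?v x\<bar> powr ps)"
      using C ps by (intro integrable_const_bound[where B = "C powr ps"]) (auto intro!: AE_I2 powr_mono2)
    then have "(\<integral>\<^sup>+x. ennreal (\<bar>?v x\<bar> powr ps) \<partial>M) = ennreal A"
      unfolding A_def by (rule nn_integral_eq_integral) auto
    with Ale show ?thesis by (simp add: ennreal_leI)
  qed
  have liminf_eq: "AE x in M. liminf (\<lambda>k. ennreal (\<bar>Q (\<phi> k x)\<bar> powr ps)) = ennreal (\<bar>Q (u x)\<bar> powr ps)"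
    using \<phi>(2)
  proof eventually_elim
    case (elim x)
    have c: "continuous_on UNIV (\<lambda>t. \<bar>Q t\<bar> powr ps)"
      using continuous_norm_powr[OF cQ ps] by simp
    then have "isCont (\<lambda>t. \<bar>Q t\<bar> powr ps) (u x)" by (auto simp: continuous_on_eq_continuous_at)
    then have "(\<lambda>k. \<bar>Q (\<phi> k x)\<bar> powr ps) \<longlonglongrightarrow> \<bar>Q (u x)\<bar> powr ps"
      by (rule isCont_tendsto_compose[OF _ elim])
    then have "(\<lambda>k. ennreal (\<bar>Q (\<phi> k x)\<bar> powr ps)) \<longlonglongrightarrow> ennreal (\<bar>Q (u x)\<bar> powr ps)"
      by (rule tendsto_ennrealI)
    then show ?case by (intro lim_imp_Liminf) auto
  qed
  \<comment> \<open>\<open>Q\<close> grows linearly, so no dominating function is at hand and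
    Fatou's lemma takes over.\<close>
  have "(\<integral>\<^sup>+x. ennreal ((\<bar>u x\<bar> powr p * P (u x)) powr \<kappa>) \<partial>M) = (\<integral>\<^sup>+x. liminf (\<lambda>k. ennreal (\<bar>Q (\<phi> k x)\<bar> powr ps)) \<partial>M)"
    unfolding Qe[symmetric] using liminf_eq by (intro nn_integral_cong_AE) (auto elim: eventually_mono)
  also have "\<dots> \<le> liminf (\<lambda>k. \<integral>\<^sup>+x. ennreal (\<bar>Q (\<phi> k x)\<bar> powr ps) \<partial>M)"
    by (intro nn_integral_liminf) auto
  also have "\<dots> \<le> liminf (\<lambda>k. ennreal ((S * (J k + B * \<epsilon> k)) powr \<kappa>))"
    using step by (intro Liminf_mono always_eventually) auto
  also have "\<dots> = ennreal ((S * I) powr \<kappa>)"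
  proof (rule lim_imp_Liminf)
    have "(\<lambda>k. S * (J k + B * \<epsilon> k)) \<longlonglongrightarrow> S * (I + B * 0)"
      by (intro tendsto_intros Jlim \<epsilon>)
    then have "(\<lambda>k. S * (J k + B * \<epsilon> k)) \<longlonglongrightarrow> S * I" by simp
    moreover have "0 \<le> S * (J k + B * \<epsilon> k)" for k
      using P0 B0 D0 by (auto simp: S_def J_def \<epsilon>_def intro!: mult_nonneg_nonneg add_nonneg_nonneg integral_nonneg_AE)
    ultimately have "(\<lambda>k. (S * (J k + B * \<epsilon> k)) powr \<kappa>) \<longlonglongrightarrow> (S * I) powr \<kappa>"
      using \<kappa> by (intro tendsto_powr2 tendsto_const) (auto intro: always_eventually)
    then show "(\<lambda>k. ennreal ((S * (J k + B * \<epsilon> k)) powr \<kappa>)) \<longlonglongrightarrow> ennreal ((S * I) powr \<kappa>)"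
      by (rule tendsto_ennrealI)
  qed auto
  finally show "(\<integral>\<^sup>+x. ennreal ((\<bar>u x\<bar> powr p * P (u x)) powr (n / (n - p))) \<partial>M) \<le> ennreal ((S * I) powr (n / (n - p)))"
    unfolding \<kappa>_def .
qed

section \<open>The a priori bound\<close>

text \<open>For X \<ge> 1 the right side is at most K X^(\<kappa> r), whose exponent is below 1.
  \<open>X0\<close> is obtained before \<open>X\<close> and depends on the parameters only.\<close>

lemma bounded_of_sublinear:
  fixes \<kappa> r A Q R T :: real
  assumes \<kappa>: "0 < \<kappa>" "0 \<le> r" "\<kappa> * r < 1" and nn: "0 \<le> A" "0 \<le> Q" "0 \<le> R" "0 \<le> T"
  obtains X0 where "0 \<le> X0" "\<And>X. 0 \<le> X \<Longrightarrow> X \<le> A + Q * (R + T * X powr \<kappa>) powr r \<Longrightarrow> X \<le> X0"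
proof -
  define K where "K = A + Q * (R + T) powr r"
  have "X \<le> max 1 (K powr (1 / (1 - \<kappa> * r)))" if X: "0 \<le> X" "X \<le> A + Q * (R + T * X powr \<kappa>) powr r" for X
  proof (cases "X \<le> 1")
    case False
    then have X1: "1 \<le> X" by simp
    have one: "1 \<le> X powr \<kappa>" "1 \<le> X powr (\<kappa> * r)"
      using X1 \<kappa> by (auto intro!: ge_one_powr_ge_zero)
    have "R * 1 \<le> R * X powr \<kappa>" using one nn by (intro mult_left_mono) auto
    then have "(R + T * X powr \<kappa>) powr r \<le> ((R + T) * X powr \<kappa>) powr r"
      using \<kappa> nn by (intro powr_mono2) (auto simp: distrib_right)
    also have "\<dots> = (R + T) powr r * X powr (\<kappa> * r)"
      by (simp add: powr_mult powr_powr)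
    finally have "Q * (R + T * X powr \<kappa>) powr r \<le> Q * ((R + T) powr r * X powr (\<kappa> * r))"
      using nn by (intro mult_left_mono) auto
    moreover have "A * 1 \<le> A * X powr (\<kappa> * r)" using one nn by (intro mult_left_mono) auto
    ultimately have "X \<le> K * X powr (\<kappa> * r)" using X(2) by (simp add: K_def algebra_simps)
    then have "X powr (1 - \<kappa> * r) \<le> K" using X1 by (simp add: powr_diff divide_le_eq)
    then have "(X powr (1 - \<kappa> * r)) powr (1 / (1 - \<kappa> * r)) \<le> K powr (1 / (1 - \<kappa> * r))"
      using \<kappa> by (intro powr_mono2) auto
    moreover have "(X powr (1 - \<kappa> * r)) powr (1 / (1 - \<kappa> * r)) = X"
      using \<kappa> X1 by (simp add: powr_powr)
    ultimately show ?thesis by simp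
  qed simp
  then show ?thesis by (intro that[of "max 1 (K powr (1 / (1 - \<kappa> * r)))"]) auto
qed

text \<open>Convergence in L^p gives convergence almost everywhere along a subsequence, and the
  convergence of the gradients survives the passage to it.\<close>

lemma W1p0_approximation:
  fixes u :: "'a::euclidean_space \<Rightarrow> real"
  assumes u: "u \<in> W1p0 p \<Omega>" and p: "1 \<le> p" and \<Omega>: "\<Omega> \<in> lmeasurable"
  obtains \<phi> where "\<And>k::nat. \<phi> k \<in> test_functions \<Omega>" "AE x in lebesgue_on \<Omega>. (\<lambda>k. \<phi> k x) \<longlonglongrightarrow> u x"
    "(\<lambda>k. \<integral>x. norm (weak_grad \<Omega> u x - grad (\<phi> k) x) powr p \<partial>lebesgue_on \<Omega>) \<longlonglongrightarrow> 0"
proof -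
  obtain \<phi> where \<phi>: "\<And>k::nat. \<phi> k \<in> test_functions \<Omega>"
    "(\<lambda>n. Lp_norm p \<Omega> (\<lambda>x. u x - \<phi> n x)) \<longlonglongrightarrow> 0"
    "(\<lambda>n. Lp_norm p \<Omega> (\<lambda>x. weak_grad \<Omega> u x - grad (\<phi> n) x)) \<longlonglongrightarrow> 0"
    using u by (auto simp: W1p0_def)
  have uL: "u \<in> Lp p \<Omega>" using u by (simp add: W1p0_def W1p_def)
  have \<phi>L: "\<phi> k \<in> Lp p \<Omega>" for k
  proof -
    note T = test_functionsD[OF \<phi>(1)[of k]]
    obtain C where C: "\<And>x. norm (\<phi> k x) \<le> C"
      using bounded_range_of_bounded_support[OF T(2,4)] by blast
    have "\<phi> k \<in> borel_measurable borel" using T(2) by (rule borel_measurable_continuous_onI)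
    then have "\<phi> k \<in> borel_measurable (lebesgue_on \<Omega>)"
      by (intro measurable_restrict_space1 measurable_completion) auto
    then show ?thesis using C p by (intro Lp_bounded[OF \<Omega>]) auto
  qed
  have L: "integrable (lebesgue_on \<Omega>) (\<lambda>x. \<bar>u x - \<phi> k x\<bar> powr p)" for k
    using Lp_diff[OF uL \<phi>L, of k] p by (simp add: Lp_def)
  have "(\<lambda>k. \<integral>x. norm (\<bar>u x - \<phi> k x\<bar> powr p) \<partial>lebesgue_on \<Omega>) \<longlonglongrightarrow> 0"
    using Lp_norm_tendsto_0D[OF _ \<phi>(2)] p by simp
  from tendsto_L1_AE_subseq[OF L this] obtain r where r: "strict_mono r"
    "AE x in lebesgue_on \<Omega>. (\<lambda>k. \<bar>u x - \<phi> (r k) x\<bar> powr p) \<longlonglongrightarrow> 0"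
    by blast
  show ?thesis
  proof (rule that[of "\<lambda>k. \<phi> (r k)"])
    show "AE x in lebesgue_on \<Omega>. (\<lambda>k. \<phi> (r k) x) \<longlonglongrightarrow> u x"
      using r(2)
    proof eventually_elim
      case (elim x)
      have "(\<lambda>k. (\<bar>u x - \<phi> (r k) x\<bar> powr p) powr (1 / p)) \<longlonglongrightarrow> 0"
        by (rule tendsto_zero_powrI[OF elim tendsto_const]) (use p in auto)
      then have "(\<lambda>k. \<bar>u x - \<phi> (r k) x\<bar>) \<longlonglongrightarrow> 0"
        using p by (simp add: powr_powr)
      then have "(\<lambda>k. u x - \<phi> (r k) x) \<longlonglongrightarrow> 0"
        by (simp add: tendsto_rabs_zero_iff)
      from tendsto_diff[OF tendsto_const[of "u x"] this] show ?case by simp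
    qed
    show "(\<lambda>k. \<integral>x. norm (weak_grad \<Omega> u x - grad (\<phi> (r k)) x) powr p \<partial>lebesgue_on \<Omega>) \<longlonglongrightarrow> 0"
      using LIMSEQ_subseq_LIMSEQ[OF Lp_norm_tendsto_0D[OF _ \<phi>(3)] r(1)] p by (simp add: o_def)
  qed (rule \<phi>(1))
qed

text \<open>\<open>\<mu>\<close> and \<open>F\<close> are fixed in advance, so that C is chosen
  before \<Omega>, a, f and u and sees \<Omega> and f only through the measure and the norm.\<close>

lemma a_priori_bound:
  fixes p q \<beta> lam \<mu> F :: real
  defines "n \<equiv> real DIM('a::euclidean_space)"
  assumes p: "2 < p" "p < n" and q: "1 \<le> q" "q < n / p" and \<beta>: "0 < \<beta>"
  shows "\<exists>C. \<forall>(\<Omega> :: 'a set) a f u. open \<Omega> \<and> bounded \<Omega> \<and>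
    (AE x in lebesgue_on \<Omega>. \<forall>s \<xi>. norm (a x s \<xi>) \<le> \<beta> * (1 + norm \<xi>)) \<and>
    f \<in> Lp q \<Omega> \<and> u \<in> W1p0 p \<Omega> \<and> distributional_subsolution \<Omega> a lam p f u \<and>
    measure lebesgue \<Omega> = \<mu> \<and> Lp_norm q \<Omega> f = F \<longrightarrow>
    u \<in> Lp (n * p * q / (n - p * q)) \<Omega> \<and> Lp_norm (n * p * q / (n - p * q)) \<Omega> u \<le> C"
proof -
  define s where "s = n * p * q / (n - p * q)"
  define \<gamma> where "\<gamma> = n * p * (q - 1) / (n - p * q)"
  define \<kappa> where "\<kappa> = n / (n - p)"
  define r where "r = 1 - 1 / q"
  have pq: "0 < n - p * q" using p q by (simp add: field_simps)
  have \<kappa>: "1 < \<kappa>" using p by (simp add: \<kappa>_def)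
  have \<gamma>0: "0 \<le> \<gamma>" using p q pq by (simp add: \<gamma>_def)
  have s: "0 < s" "s = (\<gamma> + p) * \<kappa>"
  proof -
    show "0 < s" using p q pq by (simp add: s_def)
    have "\<gamma> + p = p * (n - p) * q / (n - p * q)"
    proof -
      have "(\<gamma> + p) * (n - p * q) = n * p * (q - 1) + p * (n - p * q)"
        using pq by (simp add: \<gamma>_def distrib_right)
      also have "\<dots> = p * (n - p) * q" by (simp add: algebra_simps)
      finally show ?thesis using pq by (simp add: eq_divide_eq)
    qed
    then show "s = (\<gamma> + p) * \<kappa>" using p by (simp add: s_def \<kappa>_def mult_ac)
  qed
  \<comment> \<open>\<open>r\<close> is 1/q', and \<kappa> r < 1 is equivalent to q < n/p.\<close>
  have r: "0 \<le> r" "\<kappa> * r < 1"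
    using p q pq by (auto simp: r_def \<kappa>_def field_simps)
  \<comment> \<open>\<gamma>/2 keeps the exponent m - \<gamma>/2 of the weight nonnegative, p/(p-2)
    gives the order of vanishing for \<open>flux_bound\<close>, and 1 makes \<open>m\<close>
    positive.\<close>
  obtain m :: nat where m0: "max 1 (max (\<gamma> / 2) (p / (p - 2))) \<le> real m"
    using real_arch_simple by blast
  then have m: "0 < m" "1 \<le> real m" "\<gamma> \<le> 2 * real m" "p / (p - 2) \<le> 2 * real m" by auto
  define S where "S = (p * (n - 1) / (n - p)) powr p * ((1 + 4 * real m / p) powr p * 2 powr p)"
  have S0: "0 \<le> S" by (simp add: S_def)
  obtain C1 where C1: "0 \<le> C1" "\<And>\<gamma> e t X. 0 \<le> \<gamma> \<Longrightarrow> \<gamma> \<le> 2 * real m \<Longrightarrow> 0 \<le> e \<Longrightarrow> 0 \<le> X \<Longrightarrow>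
     \<beta> * (1 + X) * X * \<bar>psi' (real m) \<gamma> e t\<bar> \<le> X powr p * psi (real m) \<gamma> e t / 2 + C1 * (1 + psi (real m) \<gamma> e t)"
    using flux_bound[of p \<beta> "real m"] p \<beta> m by auto
  \<comment> \<open>By Hoelder and Sobolev, \<open>S2\<close> times the energy I bounds the integral
    of |u|^p P(u). With \<open>d\<close> below, that term costs at most I/4; the flux costs I/2, so
    I/4 remains, whence the factors 4 in \<open>X0\<close>.\<close>
  define S2 where "S2 = \<mu> powr (1 - 1 / \<kappa>) * S"
  have S20: "0 \<le> S2" using S0 by (simp add: S2_def)
  define d where "d = 1 / (4 * (S2 + 1))"
  have d: "0 < d" "d * S2 \<le> 1 / 4" using S20 by (auto simp: d_def field_simps)
  obtain C2 where C2: "0 \<le> C2" "\<And>e t. 0 \<le> e \<Longrightarrow>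
    C1 * (1 + psi (real m) \<gamma> e t) + \<bar>lam\<bar> * \<bar>t\<bar> * psi (real m) \<gamma> e t \<le> C2 + d * (\<bar>t\<bar> powr p * psi (real m) \<gamma> e t)"
    using lower_order_bound[of p C1 "\<bar>lam\<bar>" d \<gamma> "real m"] p C1(1) d(1) \<gamma>0 m(3) by auto
  \<comment> \<open>The constant of \<open>psi_powr_le\<close>. For q = 1 the quotient q/(q-1) is 0
    by convention; \<open>fb\<close> treats that case separately.\<close>
  define C3 :: real where "C3 = 2 powr (\<gamma> * (q / (q - 1)) / 2)"
  have C30: "0 \<le> C3" by (simp add: C3_def)
  \<comment> \<open>The absolute values are there because \<open>\<mu>\<close> and \<open>F\<close>
    are arbitrary reals up to this point. The summand 1 keeps the base positive: for q = 1 the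
    exponent \<open>r\<close> is 0, and \<open>0 powr 0\<close> would be 0.\<close>
  obtain X0 where X0: "0 \<le> X0" "\<And>X. 0 \<le> X \<Longrightarrow>
      X \<le> 4 * (C2 * \<bar>\<mu>\<bar>) + 4 * \<bar>F\<bar> * ((1 + C3 * \<bar>\<mu>\<bar>) + (C3 * S powr \<kappa>) * X powr \<kappa>) powr r \<Longrightarrow> X \<le> X0"
    using bounded_of_sublinear[of \<kappa> r "4 * (C2 * \<bar>\<mu>\<bar>)" "4 * \<bar>F\<bar>" "1 + C3 * \<bar>\<mu>\<bar>" "C3 * S powr \<kappa>"] \<kappa> r C2(1) C30 by auto
  define Z where "Z = \<mu> + 2 powr (real m * \<kappa>) * (S * X0) powr \<kappa>"
  have "u \<in> Lp s \<Omega> \<and> Lp_norm s \<Omega> u \<le> Z powr (1 / s)"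
    if \<Omega>: "open \<Omega>" "bounded \<Omega>" and growth: "AE x in lebesgue_on \<Omega>. \<forall>s \<xi>. norm (a x s \<xi>) \<le> \<beta> * (1 + norm \<xi>)"
      and f: "f \<in> Lp q \<Omega>" and u: "u \<in> W1p0 p \<Omega>" and sub: "distributional_subsolution \<Omega> a lam p f u"
      and \<mu>: "measure lebesgue \<Omega> = \<mu>" and F: "Lp_norm q \<Omega> f = F"
    for \<Omega> :: "'a set" and a f u
  proof -
    define M where "M = lebesgue_on \<Omega>"
    have \<Omega>m: "\<Omega> \<in> lmeasurable" using \<Omega> by (auto intro: lmeasurable_open)
    interpret finite_measure M unfolding M_def by (rule finite_measure_lebesgue_on[OF \<Omega>m])
    have mM: "measure M (space M) = \<mu>"
      unfolding M_def using \<mu> \<Omega>m by (simp add: measure_restrict_space space_restrict_space fmeasurableD)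
    have \<mu>0: "0 \<le> \<mu>" using \<mu> by auto
    have F0: "0 \<le> F" using F by (auto simp: Lp_norm_def)
    define g where "g = weak_grad \<Omega> u"
    have uL: "u \<in> Lp p \<Omega>" and gL: "g \<in> Lp p \<Omega>" using u by (auto simp: W1p0_def W1p_def g_def)
    have [measurable]: "u \<in> borel_measurable M" "g \<in> borel_measurable M" "f \<in> borel_measurable M"
      using uL gL f unfolding M_def by (auto simp: Lp_def)
    have fi: "integrable M f" unfolding M_def using f q(1) \<Omega>m by (rule integrable_Lp)
    have ui: "integrable M u" unfolding M_def using uL p \<Omega>m by (intro integrable_Lp[of u p]) auto
    have gp: "integrable M (\<lambda>x. norm (g x) powr p)" using gL by (simp add: Lp_def M_def)
    have up: "integrable M (\<lambda>x. \<bar>u x\<bar> powr p)" using uL by (simp add: Lp_def M_def)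
    have fq: "integrable M (\<lambda>x. \<bar>f x\<bar> powr q)" using f by (simp add: Lp_def M_def)
    have Fq: "F = (\<integral>x. \<bar>f x\<bar> powr q \<partial>M) powr (1 / q)" using F by (simp add: Lp_norm_def M_def)
    obtain \<phi> where \<phi>: "\<And>k::nat. \<phi> k \<in> test_functions \<Omega>" "AE x in M. (\<lambda>k. \<phi> k x) \<longlonglongrightarrow> u x"
      "(\<lambda>k. \<integral>x. norm (g x - grad (\<phi> k) x) powr p \<partial>M) \<longlonglongrightarrow> 0"
      using W1p0_approximation[OF u _ \<Omega>m] p unfolding M_def g_def by auto
    \<comment> \<open>\<open>S\<close> and \<open>X0\<close> were fixed before \<open>e\<close>,
      which allows e to tend to 0 afterwards.\<close>
    have unif: "(\<integral>\<^sup>+x. ennreal ((\<bar>u x\<bar> powr p * psi (real m) \<gamma> e (u x)) powr \<kappa>) \<partial>M) \<le> ennreal ((S * X0) powr \<kappa>)"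
      if e: "0 < e" "e \<le> 1" for e
    proof -
      define P where "P = psi (real m) \<gamma> e"
      define I where "I = (\<integral>x. norm (g x) powr p * P (u x) \<partial>M)"
      note E = energy_estimates[OF \<Omega> p[unfolded n_def] \<beta> growth fi[unfolded M_def] uL g_def gL
          \<phi>(1) \<phi>(2,3)[unfolded M_def] sub m(1) \<gamma>0 m(3) e,
          folded M_def n_def, folded P_def I_def, folded S_def \<kappa>_def, folded I_def]
      have P0: "0 \<le> P t" for t by (simp add: P_def psi_nonneg)
      define B where "B = e powr (- (\<gamma> / 2))"
      have PB: "\<bar>P t\<bar> \<le> B" for t
        unfolding P_def B_def using psi_bounded[OF \<gamma>0 m(3) e] psi_nonneg by simp
      have "continuous_on UNIV P"
        unfolding P_def psi_def[abs_def] using m e by (intro continuous_wt) auto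
      then have [measurable]: "P \<in> borel_measurable borel" by (rule borel_measurable_continuous_onI)
      have I0: "0 \<le> I" unfolding I_def using P0 by (intro integral_nonneg_AE) auto
      have Pi: "integrable M (\<lambda>x. P (u x))"
        using PB by (intro integrable_const_bound[where B = B]) auto
      have uP: "integrable M (\<lambda>x. \<bar>u x\<bar> * P (u x))" and fP: "integrable M (\<lambda>x. \<bar>f x\<bar> * P (u x))"
        and gP: "integrable M (\<lambda>x. norm (g x) powr p * P (u x))" and upP: "integrable M (\<lambda>x. \<bar>u x\<bar> powr p * P (u x))"
        using ui fi gp up PB by (auto intro!: integrable_mult_bounded[where C = B])
      have upP0: "0 \<le> \<bar>u x\<bar> powr p * P (u x)" for x using P0 by simp
      define Y where "Y = (\<integral>x. (\<bar>u x\<bar> powr p * P (u x)) powr \<kappa> \<partial>M)"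
      have Yi: "integrable M (\<lambda>x. (\<bar>u x\<bar> powr p * P (u x)) powr \<kappa>)"
        using E(2) by (intro integrableI_nonneg) (auto intro: le_less_trans)
      have Y: "0 \<le> Y" "Y \<le> (S * I) powr \<kappa>"
        using E(2) unfolding Y_def by (auto simp: nn_integral_eq_integral[OF Yi])
      have Yu: "(\<integral>x. \<bar>u x\<bar> powr p * P (u x) \<partial>M) \<le> S2 * I"
      proof -
        have "(\<integral>x. 1 powr (1 - 1 / \<kappa>) * ((\<bar>u x\<bar> powr p * P (u x)) powr \<kappa>) powr (1 / \<kappa>) \<partial>M)
            \<le> (\<integral>x. 1 \<partial>M) powr (1 - 1 / \<kappa>) * Y powr (1 / \<kappa>)"
          unfolding Y_def using \<kappa> Yi by (intro integral_Holder) auto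
        also have "\<dots> \<le> \<mu> powr (1 - 1 / \<kappa>) * ((S * I) powr \<kappa>) powr (1 / \<kappa>)"
          using Y \<kappa> mM by (intro mult_mono powr_mono2) auto
        also have "\<dots> = S2 * I" using \<kappa> S0 I0 by (simp add: S2_def powr_powr)
        finally show ?thesis using \<kappa> upP0 by (simp add: powr_powr)
      qed
      have fb: "(\<integral>x. \<bar>f x\<bar> * P (u x) \<partial>M) \<le> F * (1 + C3 * (\<mu> + Y)) powr r"
      proof (cases "q = 1")
        case True
        then have "\<gamma> = 0" by (simp add: \<gamma>_def)
        then have "P t \<le> 1" for t
          using psi_le_powr[OF \<gamma>0 m(3), of e t] e by (simp add: P_def split: if_splits)
        then have "(\<integral>x. \<bar>f x\<bar> * P (u x) \<partial>M) \<le> (\<integral>x. \<bar>f x\<bar> \<partial>M)"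
          using fP fi by (intro integral_mono) (auto intro!: mult_left_le)
        also have "\<dots> = F" using True by (simp add: Fq)
        also have "\<dots> = F * (1 + C3 * (\<mu> + Y)) powr r"
        proof -
          have "0 \<le> C3 * (\<mu> + Y)" using C30 \<mu>0 Y by simp
          then show ?thesis using True by (simp add: r_def)
        qed
        finally show ?thesis .
      next
        case False
        then have q1: "1 < q" using q by simp
        define q' where "q' = q / (q - 1)"
        have q': "0 < q'" "q' * r = 1" "\<kappa> \<le> q'" "\<gamma> * (q' - \<kappa>) = p * \<kappa>"
        proof -
          show "0 < q'" "q' * r = 1" using q1 by (auto simp: q'_def r_def field_simps)
          have gq: "\<gamma> * q' = s" using q1 by (simp add: \<gamma>_def q'_def s_def)
          then show 4: "\<gamma> * (q' - \<kappa>) = p * \<kappa>" using s(2) by (simp add: algebra_simps)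
          have "0 < \<gamma> * (q' - \<kappa>)" unfolding 4 using p \<kappa> by simp
          then show "\<kappa> \<le> q'" using \<gamma>0 by (auto simp: zero_less_mult_iff)
        qed
        have Pq: "P (u x) powr q' \<le> C3 * (1 + (\<bar>u x\<bar> powr p * P (u x)) powr \<kappa>)" for x
          unfolding P_def C3_def q'_def[symmetric] using \<gamma>0 m e \<kappa> q' p by (intro psi_powr_le) auto
        have iPq: "integrable M (\<lambda>x. P (u x) powr q')"
          by (rule Bochner_Integration.integrable_bound[where f = "\<lambda>x. C3 * (1 + (\<bar>u x\<bar> powr p * P (u x)) powr \<kappa>)"])
            (use Yi Pq in \<open>auto intro!: AE_I2 order_trans[OF Pq abs_ge_self]\<close>)
        have "(\<integral>x. P (u x) powr q' \<partial>M) \<le> (\<integral>x. C3 * (1 + (\<bar>u x\<bar> powr p * P (u x)) powr \<kappa>) \<partial>M)"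
          using Yi iPq Pq by (intro integral_mono) auto
        also have "\<dots> = C3 * (\<mu> + Y)" using Yi mM by (simp add: Y_def)
        finally have "(\<integral>x. P (u x) powr q' \<partial>M) \<le> 1 + C3 * (\<mu> + Y)" by simp
        then have le: "(\<integral>x. P (u x) powr q' \<partial>M) powr r \<le> (1 + C3 * (\<mu> + Y)) powr r"
          using r by (intro powr_mono2 integral_nonneg_AE) auto
        have "(\<integral>x. (\<bar>f x\<bar> powr q) powr (1 / q) * (P (u x) powr q') powr r \<partial>M)
            \<le> (\<integral>x. \<bar>f x\<bar> powr q \<partial>M) powr (1 / q) * (\<integral>x. P (u x) powr q' \<partial>M) powr r"
          using q1 fq iPq by (intro integral_Holder) (auto simp: r_def)
        also have "\<dots> \<le> F * (1 + C3 * (\<mu> + Y)) powr r"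
          unfolding Fq[symmetric] using le F0 by (rule mult_left_mono)
        finally show ?thesis using q1 q' P0 by (simp add: powr_powr)
      qed
      have fl: "(\<integral>x. \<beta> * (1 + norm (g x)) * norm (g x) * \<bar>psi' (real m) \<gamma> e (u x)\<bar> \<partial>M)
          \<le> (\<integral>x. norm (g x) powr p * P (u x) / 2 + C1 * (1 + P (u x)) \<partial>M)"
      proof (rule order_trans[OF abs_ge_self abs_integral_le_of_AE_bound])
        show "AE x in M. \<bar>\<beta> * (1 + norm (g x)) * norm (g x) * \<bar>psi' (real m) \<gamma> e (u x)\<bar>\<bar>
            \<le> norm (g x) powr p * P (u x) / 2 + C1 * (1 + P (u x))"
          using C1(2)[OF \<gamma>0 m(3), of e] e \<beta> by (simp add: P_def abs_mult)
      qed (use gP Pi in simp)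
      also have "\<dots> = I / 2 + (\<integral>x. C1 * (1 + P (u x)) \<partial>M)"
        using gP Pi by (simp add: I_def)
      finally have fl': "(\<integral>x. \<beta> * (1 + norm (g x)) * norm (g x) * \<bar>psi' (real m) \<gamma> e (u x)\<bar> \<partial>M)
          \<le> I / 2 + (\<integral>x. C1 * (1 + P (u x)) \<partial>M)" .
      have "(\<integral>x. C1 * (1 + P (u x)) \<partial>M) + \<bar>lam\<bar> * (\<integral>x. \<bar>u x\<bar> * P (u x) \<partial>M)
          = (\<integral>x. C1 * (1 + P (u x)) + \<bar>lam\<bar> * (\<bar>u x\<bar> * P (u x)) \<partial>M)"
        using Pi uP by simp
      also have "\<dots> \<le> (\<integral>x. C2 + d * (\<bar>u x\<bar> powr p * P (u x)) \<partial>M)"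
        using C2(2)[of e] e Pi uP upP by (intro integral_mono) (auto simp: P_def mult.assoc)
      also have "\<dots> = C2 * \<mu> + d * (\<integral>x. \<bar>u x\<bar> powr p * P (u x) \<partial>M)"
        using upP mM by (simp add: mult.commute)
      also have "\<dots> \<le> C2 * \<mu> + I / 4"
      proof -
        have "d * (\<integral>x. \<bar>u x\<bar> powr p * P (u x) \<partial>M) \<le> d * (S2 * I)"
          using Yu d(1) by (intro mult_left_mono) auto
        also have "\<dots> = (d * S2) * I" by simp
        also have "\<dots> \<le> 1 / 4 * I" using d(2) I0 by (rule mult_right_mono)
        finally show ?thesis by simp
      qed
      finally have "I \<le> F * (1 + C3 * (\<mu> + Y)) powr r + (I / 2 + (C2 * \<mu> + I / 4))"
        using E(1) fb fl' by linarith
      \<comment> \<open>Three quarters of \<open>I\<close> move to the left. By \<open>gP\<close>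
        the number \<open>I\<close> is a genuine finite integral, because \<open>P\<close> is
        bounded.\<close>
      then have "I \<le> 4 * (C2 * \<mu>) + 4 * F * (1 + C3 * (\<mu> + Y)) powr r" by simp
      also have "\<dots> \<le> 4 * (C2 * \<mu>) + 4 * F * ((1 + C3 * \<mu>) + (C3 * S powr \<kappa>) * I powr \<kappa>) powr r"
      proof -
        have "C3 * Y \<le> C3 * (S powr \<kappa> * I powr \<kappa>)"
          using Y C30 by (intro mult_left_mono) (auto simp: powr_mult)
        then have "1 + C3 * (\<mu> + Y) \<le> (1 + C3 * \<mu>) + (C3 * S powr \<kappa>) * I powr \<kappa>"
          by (simp add: algebra_simps)
        then show ?thesis
          using F0 r C30 \<mu>0 Y by (intro add_left_mono mult_left_mono powr_mono2) auto
      qed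
      finally have "I \<le> X0"
        using X0(2)[OF I0] F0 \<mu>0 by simp
      then have "(S * I) powr \<kappa> \<le> (S * X0) powr \<kappa>"
        using S0 I0 \<kappa> by (intro powr_mono2 mult_left_mono) auto
      then show ?thesis
        using E(2) unfolding P_def by (meson ennreal_leI order_trans)
    qed
    \<comment> \<open>The truncation is removed along this sequence by Fatou's lemma.\<close>
    define e where "e k = 1 / real (Suc k)" for k
    have e: "0 < e k" "e k \<le> 1" for k by (auto simp: e_def)
    have e0: "filterlim e (at_right 0) sequentially"
      unfolding filterlim_at using e LIMSEQ_inverse_real_of_nat
      by (auto simp: e_def[abs_def] inverse_eq_divide intro!: always_eventually)
    have lim: "(\<lambda>k. (\<bar>t\<bar> powr p * psi (real m) \<gamma> (e k) t) powr \<kappa>) \<longlonglongrightarrow> (\<bar>t\<bar> powr p * psi (real m) \<gamma> 0 t) powr \<kappa>" for t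
      using \<kappa> psi_nonneg
      by (intro tendsto_powr2 tendsto_mult tendsto_const filterlim_compose[OF tendsto_psi_0 e0])
        (auto intro!: always_eventually)
    have mp: "(\<lambda>x. (\<bar>u x\<bar> powr p * psi (real m) \<gamma> e (u x)) powr \<kappa>) \<in> borel_measurable M" if "0 \<le> e" for e
    proof -
      have "continuous_on UNIV (psi (real m) \<gamma> e)"
        unfolding psi_def[abs_def] using m that by (intro continuous_wt) auto
      then have [measurable]: "psi (real m) \<gamma> e \<in> borel_measurable borel" by (rule borel_measurable_continuous_onI)
      show ?thesis by measurable
    qed
    have b0: "(\<integral>\<^sup>+x. ennreal ((\<bar>u x\<bar> powr p * psi (real m) \<gamma> 0 (u x)) powr \<kappa>) \<partial>M) \<le> ennreal ((S * X0) powr \<kappa>)"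
    proof -
      have "(\<integral>\<^sup>+x. ennreal ((\<bar>u x\<bar> powr p * psi (real m) \<gamma> 0 (u x)) powr \<kappa>) \<partial>M)
          = (\<integral>\<^sup>+x. liminf (\<lambda>k. ennreal ((\<bar>u x\<bar> powr p * psi (real m) \<gamma> (e k) (u x)) powr \<kappa>)) \<partial>M)"
        by (intro nn_integral_cong lim_imp_Liminf[symmetric] tendsto_ennrealI lim) auto
      also have "\<dots> \<le> liminf (\<lambda>k. \<integral>\<^sup>+x. ennreal ((\<bar>u x\<bar> powr p * psi (real m) \<gamma> (e k) (u x)) powr \<kappa>) \<partial>M)"
        using mp e by (intro nn_integral_liminf measurable_compose[OF _ measurable_ennreal]) (auto simp: less_imp_le)
      also have "\<dots> \<le> liminf (\<lambda>k::nat. ennreal ((S * X0) powr \<kappa>))"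
        using unif[OF e] by (intro Liminf_mono always_eventually) auto
      also have "\<dots> = ennreal ((S * X0) powr \<kappa>)" by (simp add: Liminf_const)
      finally show ?thesis .
    qed
    \<comment> \<open>For |t| > 1 this is s = (\<gamma> + p) \<kappa> together with
      \<open>powr_le_psi_0\<close>. The summand 1 covers |t| \<le> 1, where the weight may be far
      smaller than |t|^\<gamma>.\<close>
    have pt: "\<bar>t\<bar> powr s \<le> 1 + 2 powr (real m * \<kappa>) * (\<bar>t\<bar> powr p * psi (real m) \<gamma> 0 t) powr \<kappa>" for t
    proof (cases "\<bar>t\<bar> \<le> 1")
      case True
      then have "\<bar>t\<bar> powr s \<le> 1 powr s" using s by (intro powr_mono2) auto
      also have "\<dots> \<le> 1 + 2 powr (real m * \<kappa>) * (\<bar>t\<bar> powr p * psi (real m) \<gamma> 0 t) powr \<kappa>" by simp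
      finally show ?thesis .
    next
      case False
      have "\<bar>t\<bar> powr s = (\<bar>t\<bar> powr \<gamma> * \<bar>t\<bar> powr p) powr \<kappa>"
        by (simp add: s(2) powr_powr powr_add[symmetric])
      also have "\<dots> \<le> ((2 powr real m * psi (real m) \<gamma> 0 t) * \<bar>t\<bar> powr p) powr \<kappa>"
        using powr_le_psi_0[OF \<gamma>0 m(3), of t] False \<kappa> by (intro powr_mono2 mult_right_mono) auto
      also have "\<dots> = 2 powr (real m * \<kappa>) * (\<bar>t\<bar> powr p * psi (real m) \<gamma> 0 t) powr \<kappa>"
        by (simp add: powr_mult powr_powr)
      finally show ?thesis by simp
    qed
    have nle: "(\<integral>\<^sup>+x. ennreal (\<bar>u x\<bar> powr s) \<partial>M) \<le> ennreal Z"
    proof -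
      have "(\<integral>\<^sup>+x. ennreal (\<bar>u x\<bar> powr s) \<partial>M)
          \<le> (\<integral>\<^sup>+x. 1 + ennreal (2 powr (real m * \<kappa>)) * ennreal ((\<bar>u x\<bar> powr p * psi (real m) \<gamma> 0 (u x)) powr \<kappa>) \<partial>M)"
        using pt by (intro nn_integral_mono) (simp flip: ennreal_1 ennreal_mult ennreal_plus)
      also have "\<dots> = emeasure M (space M) + ennreal (2 powr (real m * \<kappa>)) * (\<integral>\<^sup>+x. ennreal ((\<bar>u x\<bar> powr p * psi (real m) \<gamma> 0 (u x)) powr \<kappa>) \<partial>M)"
        using mp[of 0] by (simp add: nn_integral_add nn_integral_cmult)
      also have "\<dots> \<le> ennreal \<mu> + ennreal (2 powr (real m * \<kappa>)) * ennreal ((S * X0) powr \<kappa>)"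
        using b0 by (intro add_mono mult_left_mono) (auto simp: emeasure_eq_measure mM)
      also have "\<dots> = ennreal Z"
        using \<mu>0 by (simp add: Z_def ennreal_plus ennreal_mult)
      finally show ?thesis .
    qed
    have ui: "integrable M (\<lambda>x. \<bar>u x\<bar> powr s)"
      using nle by (intro integrableI_nonneg) (auto intro: le_less_trans)
    have "(\<integral>x. \<bar>u x\<bar> powr s \<partial>M) \<le> Z"
    proof -
      have "0 \<le> Z" using \<mu>0 by (simp add: Z_def)
      then show ?thesis
        using nle unfolding nn_integral_eq_integral[OF ui AE_I2[OF powr_ge_zero]]
        by (simp only: ennreal_le_iff)
    qed
    then have "(\<integral>x. \<bar>u x\<bar> powr s \<partial>M) powr (1 / s) \<le> Z powr (1 / s)"
      using s by (intro powr_mono2 integral_nonneg_AE) auto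
    then show ?thesis
      using ui by (simp add: Lp_def Lp_norm_def M_def[symmetric])
  qed
  then show ?thesis
    unfolding s_def[symmetric] by blast
qed

theorem theorem5p1:
  shows "\<exists>(C\<^sub>1 :: real \<Rightarrow> real \<Rightarrow> real \<Rightarrow> real \<Rightarrow> real \<Rightarrow> real \<Rightarrow> real)
          (C\<^sub>2 :: real \<Rightarrow> real \<Rightarrow> real \<Rightarrow> real \<Rightarrow> real \<Rightarrow> real \<Rightarrow> real \<Rightarrow> real).
    \<forall>(\<Omega> :: (real^'n) set) (a :: real^'n \<Rightarrow> real \<Rightarrow> real^'n \<Rightarrow> real^'n)
      (\<beta> :: real) (p :: real) (lam :: real) (q :: real)
      (f :: real^'n \<Rightarrow> real) (u :: real^'n \<Rightarrow> real) (N :: real) (s :: real).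
      N = real CARD('n) \<and>
      bounded \<Omega> \<and> open \<Omega> \<and>
      caratheodory \<Omega> a \<and>
      \<beta> > 0 \<and>
      (AE x in lebesgue_on \<Omega>. \<forall>s \<xi>. norm (a x s \<xi>) \<le> \<beta> * (1 + norm \<xi>)) \<and>
      2 < p \<and> p < N \<and>
      1 \<le> q \<and> q < N / p \<and>
      f \<in> Lp q \<Omega> \<and>
      u \<in> W1p0 p \<Omega> \<and>
      distributional_subsolution \<Omega> a lam p f u \<and>
      s = N * p * q / (N - p * q)
      \<longrightarrow>
      u \<in> Lp s \<Omega> \<and>
      (N * (p - 1) / (N * (p - 2) + p) \<le> q \<longrightarrow>
         Lp_norm s \<Omega> u \<le> C\<^sub>1 \<beta> p q lam (measure lebesgue \<Omega>) (Lp_norm q \<Omega> f)) \<and>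
      (q < N * (p - 1) / (N * (p - 2) + p) \<longrightarrow>
         Lp_norm s \<Omega> u \<le> C\<^sub>2 \<beta> p q lam (measure lebesgue \<Omega>) (Lp_norm q \<Omega> f)
                             (Lp_norm p \<Omega> (weak_grad \<Omega> u)))"
proof -
  define bound where "bound \<beta> p q lam \<mu> F C \<longleftrightarrow> (\<forall>(\<Omega> :: (real^'n) set) a f u. open \<Omega> \<and> bounded \<Omega> \<and>
    (AE x in lebesgue_on \<Omega>. \<forall>s \<xi>. norm (a x s \<xi>) \<le> \<beta> * (1 + norm \<xi>)) \<and>
    f \<in> Lp q \<Omega> \<and> u \<in> W1p0 p \<Omega> \<and> distributional_subsolution \<Omega> a lam p f u \<and>
    measure lebesgue \<Omega> = \<mu> \<and> Lp_norm q \<Omega> f = F \<longrightarrow>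
    u \<in> Lp (real CARD('n) * p * q / (real CARD('n) - p * q)) \<Omega> \<and>
    Lp_norm (real CARD('n) * p * q / (real CARD('n) - p * q)) \<Omega> u \<le> C)"
    for \<beta> p q lam \<mu> F C :: real
  \<comment> \<open>Choice turns the constant for each tuple of parameters into a function of them;
    the dimension enters through the type.\<close>
  define C where "C \<beta> p q lam \<mu> F = (SOME C. bound \<beta> p q lam \<mu> F C)" for \<beta> p q lam \<mu> F
  have C: "bound \<beta> p q lam \<mu> F (C \<beta> p q lam \<mu> F)"
    if "2 < p" "p < real CARD('n)" "1 \<le> q" "q < real CARD('n) / p" "0 < \<beta>" for \<beta> p q lam \<mu> F
  proof -
    have "\<exists>C. bound \<beta> p q lam \<mu> F C"
      using a_priori_bound[where 'a = "real^'n", of p q \<beta> lam \<mu> F] that unfolding bound_def by simp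
    then show ?thesis unfolding C_def by (rule someI_ex)
  qed
  \<comment> \<open>\<open>a_priori_bound\<close> covers the whole range of q, so the same constant
    serves both cases; the second witness is constant in its last argument.\<close>
  show ?thesis
  proof (intro exI[of _ C] exI[of _ "\<lambda>\<beta> p q lam \<mu> F G. C \<beta> p q lam \<mu> F"] allI impI, elim conjE)
    fix \<Omega> :: "(real^'n) set" and a :: "real^'n \<Rightarrow> real \<Rightarrow> real^'n \<Rightarrow> real^'n"
      and \<beta> p lam q :: real and f u :: "real^'n \<Rightarrow> real" and N s :: real
    assume N: "N = real CARD('n)" and s: "s = N * p * q / (N - p * q)"
      and par: "0 < \<beta>" "2 < p" "p < N" "1 \<le> q" "q < N / p"
      and hyps: "bounded \<Omega>" "open \<Omega>" "AE x in lebesgue_on \<Omega>. \<forall>s \<xi>. norm (a x s \<xi>) \<le> \<beta> * (1 + norm \<xi>)"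
        "f \<in> Lp q \<Omega>" "u \<in> W1p0 p \<Omega>" "distributional_subsolution \<Omega> a lam p f u"
    have "u \<in> Lp s \<Omega> \<and> Lp_norm s \<Omega> u \<le> C \<beta> p q lam (measure lebesgue \<Omega>) (Lp_norm q \<Omega> f)"
      using C[unfolded bound_def, rule_format, of p q \<beta> \<Omega> a f u lam] par hyps unfolding s N by blast
    then show "u \<in> Lp s \<Omega> \<and>
      (N * (p - 1) / (N * (p - 2) + p) \<le> q \<longrightarrow>
         Lp_norm s \<Omega> u \<le> C \<beta> p q lam (measure lebesgue \<Omega>) (Lp_norm q \<Omega> f)) \<and>
      (q < N * (p - 1) / (N * (p - 2) + p) \<longrightarrow>
         Lp_norm s \<Omega> u \<le> C \<beta> p q lam (measure lebesgue \<Omega>) (Lp_norm q \<Omega> f))"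
      by blast
  qed
qed

end
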